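(* Let $m\ge2$ be an integer, $0<\alpha<1$, $d\in\mathbb R$ with $\alpha m<1$ and $2d+\alpha m<1$. Let $$\Lambda_m=\sup_{\|\xi\|_{\mathfrak H_{\mathbb R}}\le1}\left|\langle Q_1,\xi^{\otimes m}\rangle_{\mathfrak H_{\mathbb R}^{\otimes m}}\right|.$$ Then $$0<L_{m,\alpha,d}\le\Lambda_m\le(m!)^{-1/2},$$ where the upper bound $(m!)^{-1/2}$ is the Hilbert--Schmidt norm $\|Q_1\|_{L^2(\mathbb R^m)}$ of $Q_1$, and $$L_{m,\alpha,d}:=\Big(\frac{2-\alpha}{2(1-\alpha)}\Big)^{m/2}\frac{\sum_{k=0}^m\binom mk\mathrm B\big(1-d+(1-\alpha)k,\;1+(1-\alpha)(m-k)\big)}{(m!\,I_{m,\alpha,d})^{1/2}},\qquad I_{m,\alpha,d}=\frac{2\,\mathrm B(1-d,1-\alpha m)}{2-2d-\alpha m},$$ with $\mathrm B(\cdot,\cdot)$ the beta function.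
   Context: $\mathfrak H_{\mathbb R}:=\{h\in L^2(\mathbb R;\mathbb C):h(-x)=\overline{h(x)}\}$ is a real Hilbert space with inner product $\langle h,g\rangle=\operatorname{Re}\int_{\mathbb R}h\overline g\,dx$; tensor powers are over this real Hilbert space, so for Hermitian-symmetric $F\in L^2(\mathbb R^m;\mathbb C)$, $\langle F,\xi^{\otimes m}\rangle_{\mathfrak H_{\mathbb R}^{\otimes m}}=\operatorname{Re}\int_{\mathbb R^m}F(x)\prod_{j=1}^m\overline{\xi(x_j)}\,dx$. The kernel is $$Q_1(x_1,\dots,x_m)=C_{m,\alpha,d}\Big(\int_0^1y^{-d}e^{iy(x_1+\cdots+x_m)}\,dy\Big)\prod_{j=1}^m|x_j|^{(\alpha-1)/2},\qquad C_{m,\alpha,d}=\epsilon\,(m!\,c_\alpha^m\,I_{m,\alpha,d})^{-1/2},$$ where $\epsilon\in\{-1,1\}$ is a fixed sign (the sign of a nonzero Hermite coefficient $J_m$ of the functional under study), $c_\alpha=2\Gamma(\alpha)\cos(\pi\alpha/2)$, and $I_{m,\alpha,d}=\int_0^1\int_0^1y^{-d}z^{-d}|y-z|^{-\alpha m}\,dy\,dz$, which equals the beta-function expression in the claim. *)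

theory Defs
  imports "HOL-Analysis.Analysis"
begin

text \<open>\<open>\<real>\<^sup>m\<close> is represented by the product measure over the index set \<open>{..<m}\<close>. Elements of
  \<open>L\<^sup>2\<close>-spaces are represented by functions, not by classes modulo null sets; accordingly the symmetry
  defining the real Hilbert space below is only required almost everywhere.\<close>

abbreviation leb_pow :: "nat \<Rightarrow> (nat \<Rightarrow> real) measure" where
  "leb_pow m \<equiv> Pi\<^sub>M {..<m} (\<lambda>_. lborel)"

definition L2_space :: "'a measure \<Rightarrow> ('a \<Rightarrow> complex) set" where
  "L2_space M = {f \<in> borel_measurable M. integrable M (\<lambda>x. (cmod (f x))\<^sup>2)}"

definition L2_norm :: "'a measure \<Rightarrow> ('a \<Rightarrow> complex) \<Rightarrow> real" where
  "L2_norm M f = sqrt (\<integral>x. (cmod (f x))\<^sup>2 \<partial>M)"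

definition re_inner :: "'a measure \<Rightarrow> ('a \<Rightarrow> complex) \<Rightarrow> ('a \<Rightarrow> complex) \<Rightarrow> real" where
  "re_inner M f g = Re (\<integral>x. f x * cnj (g x) \<partial>M)"

definition HR :: "(real \<Rightarrow> complex) set" where
  "HR = {h \<in> L2_space lborel. AE x in lborel. h (- x) = cnj (h x)}"

definition HR_norm :: "(real \<Rightarrow> complex) \<Rightarrow> real" where
  "HR_norm h = sqrt (re_inner lborel h h)"

definition tensor_power :: "nat \<Rightarrow> (real \<Rightarrow> complex) \<Rightarrow> (nat \<Rightarrow> real) \<Rightarrow> complex" where
  "tensor_power m \<xi> x = (\<Prod>j<m. \<xi> (x j))"

definition c_const :: "real \<Rightarrow> real" where
  "c_const \<alpha> = 2 * Gamma \<alpha> * cos (pi * \<alpha> / 2)"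

text \<open>In this integral and in the kernel, \<open>powr\<close> with a negative exponent takes the value \<open>0\<close> at base
  \<open>0\<close>; this occurs only on null sets.\<close>

definition I_const :: "nat \<Rightarrow> real \<Rightarrow> real \<Rightarrow> real" where
  "I_const m \<alpha> d =
     (LINT p : {0..1} \<times> {0..1} | lborel.
        fst p powr (- d) * snd p powr (- d) * \<bar>fst p - snd p\<bar> powr (- (\<alpha> * real m)))"

definition C_const :: "real \<Rightarrow> nat \<Rightarrow> real \<Rightarrow> real \<Rightarrow> real" where
  "C_const \<epsilon> m \<alpha> d = \<epsilon> * (fact m * c_const \<alpha> ^ m * I_const m \<alpha> d) powr (- 1 / 2)"

definition Q1 :: "real \<Rightarrow> nat \<Rightarrow> real \<Rightarrow> real \<Rightarrow> (nat \<Rightarrow> real) \<Rightarrow> complex" where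
  "Q1 \<epsilon> m \<alpha> d x =
     complex_of_real (C_const \<epsilon> m \<alpha> d)
     * (LINT y : {0..1} | lborel.
          complex_of_real (y powr (- d)) * exp (\<i> * complex_of_real (y * (\<Sum>j<m. x j))))
     * complex_of_real (\<Prod>j<m. \<bar>x j\<bar> powr ((\<alpha> - 1) / 2))"

text \<open>The supremum is taken in the extended reals, so that boundedness is not presupposed.\<close>

definition Lambda :: "real \<Rightarrow> nat \<Rightarrow> real \<Rightarrow> real \<Rightarrow> ereal" where
  "Lambda \<epsilon> m \<alpha> d =
     (SUP \<xi> \<in> {\<xi> \<in> HR. HR_norm \<xi> \<le> 1}.
        ereal \<bar>re_inner (leb_pow m) (Q1 \<epsilon> m \<alpha> d) (tensor_power m \<xi>)\<bar>)"

definition L_const :: "nat \<Rightarrow> real \<Rightarrow> real \<Rightarrow> real" where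
  "L_const m \<alpha> d =
     ((2 - \<alpha>) / (2 * (1 - \<alpha>))) powr (real m / 2)
     * (\<Sum>k=0..m. real (m choose k)
          * Beta (1 - d + (1 - \<alpha>) * real k) (1 + (1 - \<alpha>) * real (m - k)))
     / (fact m * I_const m \<alpha> d) powr (1 / 2)"

end

theory Submission
  imports Defs "HOL-Probability.Probability"
begin

text \<open>Up to the factor \<open>\<bar>x\<^sub>1\<bar>\<^bsup>(\<alpha>-1)/2\<^esup> \<dots> \<bar>x\<^sub>m\<bar>\<^bsup>(\<alpha>-1)/2\<^esup>\<close>, both the kernel and the tensor powers of a suitable test
  function are Fourier transforms of finite measures on \<open>\<real>\<^sup>m\<close>, and the inner product of two such
  objects is the mutual Riesz energy of the measures, because the Fourier transform of \<open>\<bar>x\<bar>\<^bsup>\<alpha>-1\<^esup>\<close> is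
  \<open>c\<^sub>\<alpha> \<bar>u\<bar>\<^bsup>-\<alpha>\<^esup>\<close>. The latter is only conditionally convergent; it is obtained as a monotone limit by
  writing \<open>\<bar>x\<bar>\<^bsup>\<alpha>-1\<^esup>\<close> as a superposition of Gaussians \<open>exp (- t x\<^sup>2)\<close> and truncating to \<open>t > 1 / (n + 1)\<close>,
  which keeps the weights and their transforms nonnegative and dominated by their limits.
  The energy of the kernel with itself gives its Hilbert--Schmidt norm, hence the upper bound by
  Cauchy--Schwarz. The lower bound is the exact value at the normalised test function \<open>\<bar>x\<bar>\<^bsup>(\<alpha>-1)/2\<^esup> \<integral>\<^sub>0\<^sup>1 exp (i y x) dy\<close>.\<close>

section \<open>Riesz potentials as superpositions of Gaussians\<close>

text \<open>Scaling by s = 1/sqrt(2t) turns the Gaussian into a multiple of the standard normal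
  density, whose characteristic function exp(-u^2/2) is known.\<close>

lemma gaussian_fourier:
  fixes t u :: real
  assumes t: "t > 0"
  shows "integrable lborel (\<lambda>x. exp (- (t * x\<^sup>2)))"
    and "(\<integral>x. iexp (u * x) * complex_of_real (exp (- (t * x\<^sup>2))) \<partial>lborel)
           = complex_of_real (sqrt (pi / t) * exp (- (u\<^sup>2 / (4 * t))))"
proof -
  define s where "s = 1 / sqrt (2 * t)"
  have s: "s > 0" and s2: "s\<^sup>2 = 1 / (2 * t)"
    using t by (auto simp: s_def power_divide)
  have e: "exp (- (t * (s * x)\<^sup>2)) = sqrt (2 * pi) * std_normal_density x" for x
    using t by (simp add: power_mult_distrib s2 std_normal_density_def)
  have "integrable lborel (\<lambda>x. exp (- (t * (0 + s * x)\<^sup>2)))"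
    unfolding add_0 e by simp
  then show "integrable lborel (\<lambda>x. exp (- (t * x\<^sup>2)))"
    using lborel_integrable_real_affine_iff[of s "\<lambda>x. exp (- (t * x\<^sup>2))" 0] s by simp
  have "(\<integral>x. iexp (u * x) * complex_of_real (exp (- (t * x\<^sup>2))) \<partial>lborel)
      = \<bar>s\<bar> *\<^sub>R (\<integral>x. iexp (u * (0 + s * x)) * complex_of_real (exp (- (t * (0 + s * x)\<^sup>2))) \<partial>lborel)"
    using s by (intro lborel_integral_real_affine) auto
  also have "\<dots> = s * sqrt (2 * pi) * (\<integral>x. std_normal_density x *\<^sub>R iexp ((u * s) * x) \<partial>lborel)"
    unfolding add_0 e using s
    by (simp add: scaleR_conv_of_real mult_ac flip: integral_mult_right_zero)
  also have "(\<integral>x. std_normal_density x *\<^sub>R iexp ((u * s) * x) \<partial>lborel)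
      = char std_normal_distribution (u * s)"
    unfolding char_def by (subst integral_density) auto
  also have "char std_normal_distribution (u * s) = complex_of_real (exp (- (u\<^sup>2 / (4 * t))))"
    by (simp add: char_std_normal_distribution power_mult_distrib s2)
  also have "s * sqrt (2 * pi) = sqrt (pi / t)"
    using t by (simp add: s_def real_sqrt_divide real_sqrt_mult)
  finally show "(\<integral>x. iexp (u * x) * complex_of_real (exp (- (t * x\<^sup>2))) \<partial>lborel)
           = complex_of_real (sqrt (pi / t) * exp (- (u\<^sup>2 / (4 * t))))" by simp
qed

text \<open>Two substitutions in the same Gamma integral, s = tv and s = v/t. The first evaluates
  the superposition of Gaussians exp(-t x^2) with v = x^2; the second evaluates its Fourier
  transform, where t appears in the denominator and v = u^2/4.\<close>

lemma gamma_integral_scaled: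
  fixes a v :: real
  assumes a: "a > 0" and v: "v > 0"
  shows "set_integrable lborel {0<..} (\<lambda>t. t powr (a - 1) * exp (- (t * v)))"
    and "(LINT t:{0<..}|lborel. t powr (a - 1) * exp (- (t * v))) = Gamma a * v powr - a"
    and "set_integrable lborel {0<..} (\<lambda>t. t powr (- a - 1) * exp (- (v / t)))"
    and "(LINT t:{0<..}|lborel. t powr (- a - 1) * exp (- (v / t))) = Gamma a * v powr - a"
proof -
  have "((\<lambda>t. if t \<in> {0<..} then t powr (a - 1) * exp (- t) else 0) has_integral Gamma a) {0..}"
    using Gamma_integral_real[OF a] by (rule has_integral_eq[rotated]) (auto simp: exp_minus field_simps)
  then have G0: "((\<lambda>t. t powr (a - 1) * exp (- t)) has_integral Gamma a) {0<..}"
    by (subst (asm) has_integral_restrict) auto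
  then have G: "(\<lambda>t. t powr (a - 1) * exp (- t)) absolutely_integrable_on {0<..}"
    by (intro nonnegative_absolutely_integrable_1) (auto intro: has_integral_integrable)
  from G0 have G': "integral {0<..} (\<lambda>t. t powr (a - 1) * exp (- t)) = Gamma a"
    by (rule integral_unique)
  \<comment> \<open>Change of variables for a bijection g of the half-line, done once for both
    substitutions. The substitution theorem speaks of Lebesgue measurable sets and functions; Borel
    measurability of F brings the result back to \<open>lborel\<close>.\<close>
  have *: "set_integrable lborel {0<..} F \<and> (LINT t:{0<..}|lborel. F t) = Gamma a * v powr - a"
    if F: "F \<in> borel_measurable borel"
      and g: "\<And>t. t > 0 \<Longrightarrow> (g has_real_derivative g' t) (at t within {0<..})"
      and inj: "inj_on g {0<..}" and im: "g ` {0<..} = {0<..}"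
      and eq: "\<And>t. t > 0 \<Longrightarrow> \<bar>g' t\<bar> * (g t powr (a - 1) * exp (- g t)) = v powr a * F t" for F g g'
  proof -
    have "(\<lambda>t. \<bar>g' t\<bar> * (g t powr (a - 1) * exp (- g t))) absolutely_integrable_on {0<..} \<and>
       integral {0<..} (\<lambda>t. \<bar>g' t\<bar> * (g t powr (a - 1) * exp (- g t))) = Gamma a"
      using has_absolute_integral_change_of_variables_1'[of "{0<..}" g g' "\<lambda>t. t powr (a - 1) * exp (- t)" "Gamma a"]
        g inj G G' im by auto
    then have "(\<lambda>t. v powr a * F t) absolutely_integrable_on {0<..} \<and>
       integral {0<..} (\<lambda>t. v powr a * F t) = Gamma a"
      using eq by (smt (verit) greaterThan_iff integral_cong set_integrable_cong)
    then have "F absolutely_integrable_on {0<..} \<and> integral {0<..} F = Gamma a * v powr - a"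
      using v by (auto simp: powr_minus field_simps)
    moreover have "set_integrable lborel {0<..} F \<longleftrightarrow> F absolutely_integrable_on {0<..}"
      unfolding set_integrable_def using F by (subst integrable_completion) auto
    ultimately show ?thesis
      using set_borel_integral_eq_integral(2) by metis
  qed
  have A: "set_integrable lborel {0<..} (\<lambda>t. t powr (a - 1) * exp (- (t * v)))
     \<and> (LINT t:{0<..}|lborel. t powr (a - 1) * exp (- (t * v))) = Gamma a * v powr - a"
  proof (rule *[where g = "\<lambda>t. t * v" and g' = "\<lambda>t. v"])
    show "(\<lambda>t. t * v) ` {0<..} = {0<..}"
      using v by (auto intro!: image_eqI[of _ _ "_ / v"])
    show "\<bar>v\<bar> * ((t * v) powr (a - 1) * exp (- (t * v))) = v powr a * (t powr (a - 1) * exp (- (t * v)))"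
      if "t > 0" for t using v that by (simp add: powr_mult powr_diff)
  qed (use v in \<open>auto intro!: derivative_eq_intros inj_onI\<close>)
  have B: "set_integrable lborel {0<..} (\<lambda>t. t powr (- a - 1) * exp (- (v / t)))
     \<and> (LINT t:{0<..}|lborel. t powr (- a - 1) * exp (- (v / t))) = Gamma a * v powr - a"
  proof (rule *[where g = "\<lambda>t. v / t" and g' = "\<lambda>t. - v / t\<^sup>2"])
    show "(\<lambda>t. v / t) ` {0<..} = {0<..}"
      using v by (auto intro!: image_eqI[of _ _ "v / _"])
    show "\<bar>- v / t\<^sup>2\<bar> * ((v / t) powr (a - 1) * exp (- (v / t))) = v powr a * (t powr (- a - 1) * exp (- (v / t)))"
      if "t > 0" for t using v that
      by (simp add: powr_divide powr_diff powr_minus power2_eq_square field_simps)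
  qed (use v in \<open>auto intro!: derivative_eq_intros inj_onI simp: power2_eq_square\<close>)
  from A B show "set_integrable lborel {0<..} (\<lambda>t. t powr (a - 1) * exp (- (t * v)))"
    and "(LINT t:{0<..}|lborel. t powr (a - 1) * exp (- (t * v))) = Gamma a * v powr - a"
    and "set_integrable lborel {0<..} (\<lambda>t. t powr (- a - 1) * exp (- (v / t)))"
    and "(LINT t:{0<..}|lborel. t powr (- a - 1) * exp (- (v / t))) = Gamma a * v powr - a"
    by auto
qed

text \<open>For t > e the factor exp(-1/t) is at least exp(-1/e), so exp(1/e) times the convergent
  integrand of \<open>gamma_integral_scaled\<close> is a majorant. This makes the truncated
  superposition absolutely integrable in both variables.\<close>

lemma set_integrable_powr_tail:
  fixes a e :: real
  assumes a: "a > 0" and e: "e > 0"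
  shows "set_integrable lborel {e<..} (\<lambda>t. t powr (- a - 1))"
proof -
  have "set_integrable lborel {e<..} (\<lambda>t. exp (1 / e) * (t powr (- a - 1) * exp (- (1 / t))))"
    using gamma_integral_scaled(3)[OF a, of 1] e
    by (intro set_integrable_mult_right) (auto intro: set_integrable_subset)
  then show ?thesis
  proof (rule set_integrable_bound)
    have "t powr (- a - 1) * 1 \<le> t powr (- a - 1) * exp (1 / e - 1 / t)" if "t > e" for t
      using that e by (intro mult_left_mono) (auto simp: field_simps)
    from this have "t powr (- a - 1) \<le> exp (1 / e) * (t powr (- a - 1) * exp (- (1 / t)))" if "t > e" for t
      using that by (fastforce simp: mult_ac exp_diff exp_minus divide_inverse)
    then show "AE t in lborel. t \<in> {e<..} \<longrightarrow> norm (t powr (- a - 1)) \<le> norm (exp (1 / e) * (t powr (- a - 1) * exp (- (1 / t))))"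
      by (auto simp: abs_mult)
  qed (auto simp: set_borel_measurable_def)
qed

text \<open>Monotone exhaustion of the half-line by t > 1/(n+1). F is kept general because the
  weights and their Fourier transforms are truncated in the same way.\<close>

lemma truncated_integral:
  fixes F :: "real \<Rightarrow> real"
  assumes F: "set_integrable lborel {0<..} F" and nn: "\<And>t. t > 0 \<Longrightarrow> 0 \<le> F t"
  shows "mono (\<lambda>n. LINT t:{inverse (Suc n)<..}|lborel. F t)"
    and "(\<lambda>n. LINT t:{inverse (Suc n)<..}|lborel. F t) \<longlonglongrightarrow> (LINT t:{0<..}|lborel. F t)"
    and "0 \<le> (LINT t:{inverse (Suc n)<..}|lborel. F t)"
    and "(LINT t:{inverse (Suc n)<..}|lborel. F t) \<le> (LINT t:{0<..}|lborel. F t)"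
proof -
  have pos: "0 < t" if "inverse (real (Suc n)) < t" for n t
    using that by (meson inverse_positive_iff_positive less_trans of_nat_0_less_iff zero_less_Suc)
  have U: "(\<Union>n. {inverse (real (Suc n))<..}) = {0<..}"
    using pos reals_Archimedean by fastforce
  show m: "mono (\<lambda>n. LINT t:{inverse (Suc n)<..}|lborel. F t)"
  proof (rule monoI)
    fix i j :: nat assume ij: "i \<le> j"
    have "inverse (real (Suc j)) \<le> inverse (real (Suc i))" using ij by (simp add: field_simps)
    then have "t > inverse (real (Suc i)) \<Longrightarrow> t > inverse (real (Suc j))" for t
      by (rule le_less_trans)
    then show "(LINT t:{inverse (Suc i)<..}|lborel. F t) \<le> (LINT t:{inverse (Suc j)<..}|lborel. F t)"
      unfolding set_lebesgue_integral_def using pos[of i] pos[of j] nn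
      by (intro integral_mono F[THEN set_integrable_subset, unfolded set_integrable_def])
         (auto simp: indicator_def)
  qed
  show l: "(\<lambda>n. LINT t:{inverse (Suc n)<..}|lborel. F t) \<longlonglongrightarrow> (LINT t:{0<..}|lborel. F t)"
    using set_integral_cont_up[of "\<lambda>n. {inverse (real (Suc n))<..}" lborel F] F U
    by (auto simp: incseq_def field_simps)
  show "0 \<le> (LINT t:{inverse (Suc n)<..}|lborel. F t)"
    unfolding set_lebesgue_integral_def using pos[of n] nn
    by (intro integral_nonneg_AE) (auto simp: indicator_def)
  show "(LINT t:{inverse (Suc n)<..}|lborel. F t) \<le> (LINT t:{0<..}|lborel. F t)"
    using m l by (intro incseq_le)
qed

text \<open>At \<open>x = 0\<close> the integral diverges; the value \<open>0\<close> makes the convergence to \<open>\<bar>x\<bar> powr (\<alpha> - 1)\<close> hold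
  everywhere, since \<open>0 powr b = 0\<close>.\<close>

definition riesz_weight :: "real \<Rightarrow> nat \<Rightarrow> real \<Rightarrow> real" where
  "riesz_weight \<alpha> n x = (if x = 0 then 0 else
     (LINT t:{inverse (Suc n)<..}|lborel. t powr ((1 - \<alpha>) / 2 - 1) * exp (- (t * x\<^sup>2)))
       / Gamma ((1 - \<alpha>) / 2))"

text \<open>The Fourier transform of \<open>riesz_weight\<close>, taken Gaussian by Gaussian: the
  factor sqrt(pi/t) lowers the exponent of t by 1/2 and produces sqrt pi in front. Thanks to the
  truncation the integral converges at u = 0 too, so no special value is set there.\<close>

definition riesz_ft :: "real \<Rightarrow> nat \<Rightarrow> real \<Rightarrow> real" where
  "riesz_ft \<alpha> n u = sqrt pi / Gamma ((1 - \<alpha>) / 2) *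
     (LINT t:{inverse (Suc n)<..}|lborel. t powr (- (\<alpha> / 2) - 1) * exp (- (u\<^sup>2 / 4 / t)))"

section \<open>Truncated Riesz weights: monotone limits and Fourier transforms\<close>

context
  fixes \<alpha> :: real
  assumes \<alpha>: "0 < \<alpha>" "\<alpha> < 1"
begin

text \<open>Legendre duplication at \<alpha>/2 and reflection at (1+\<alpha>)/2, where the sine
  becomes cos(pi \<alpha>/2). The right-hand side is the constant that the superposition of
  Gaussians produces.\<close>

lemma c_const_eq:
  "c_const \<alpha> = sqrt pi * 2 powr \<alpha> * Gamma (\<alpha> / 2) / Gamma ((1 - \<alpha>) / 2)"
proof -
  have "Gamma (complex_of_real (\<alpha> / 2)) * Gamma (complex_of_real (\<alpha> / 2) + 1/2)
     = exp ((1 - 2 * complex_of_real (\<alpha> / 2)) * of_real (ln 2)) * of_real (sqrt pi) * Gamma (2 * complex_of_real (\<alpha> / 2))"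
    using \<alpha> by (intro Gamma_legendre_duplication) (auto elim!: nonpos_Ints_cases simp: complex_eq_iff)
  then have 1: "complex_of_real (Gamma (\<alpha> / 2) * Gamma (\<alpha> / 2 + 1/2)) = complex_of_real (exp ((1 - \<alpha>) * ln 2) * sqrt pi * Gamma \<alpha>)"
    by (simp flip: Gamma_complex_of_real exp_of_real)
  have 2: "Gamma (complex_of_real ((1 + \<alpha>) / 2)) * Gamma (1 - complex_of_real ((1 + \<alpha>) / 2))
     = of_real pi / sin (of_real pi * complex_of_real ((1 + \<alpha>) / 2))"
    by (rule Gamma_reflection_complex)
  have "sin (pi * ((1 + \<alpha>) / 2)) = sin (pi / 2 + pi * \<alpha> / 2)"
    by (simp add: field_simps)
  then have s: "sin (pi * ((1 + \<alpha>) / 2)) = cos (pi * \<alpha> / 2)"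
    by (simp add: sin_add)
  have "1 - complex_of_real ((1 + \<alpha>) / 2) = complex_of_real ((1 - \<alpha>) / 2)"
    by (simp add: field_simps)
  with 2 have 3: "complex_of_real (Gamma ((1 + \<alpha>) / 2) * Gamma ((1 - \<alpha>) / 2)) = complex_of_real (pi / sin (pi * ((1 + \<alpha>) / 2)))"
    by (simp only: Gamma_complex_of_real sin_of_real flip: of_real_mult of_real_divide)
  have c: "cos (pi * \<alpha> / 2) > 0"
    using \<alpha> mult_strict_left_mono[of \<alpha> 1 pi] mult_pos_pos[of pi \<alpha>] pi_gt_zero
    by (intro cos_gt_zero_pi) linarith+
  have g: "Gamma ((1 - \<alpha>) / 2) > 0" using \<alpha> by simp
  have 4: "Gamma ((1 + \<alpha>) / 2) = pi / (cos (pi * \<alpha> / 2) * Gamma ((1 - \<alpha>) / 2))"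
    using 3 c g unfolding of_real_eq_iff s by (simp add: field_simps)
  have "Gamma (\<alpha> / 2) * Gamma ((1 + \<alpha>) / 2) = 2 powr (1 - \<alpha>) * sqrt pi * Gamma \<alpha>"
    using 1 unfolding of_real_eq_iff by (simp add: powr_def add_divide_distrib add_ac)
  then have "Gamma (\<alpha> / 2) * (sqrt pi * sqrt pi / (cos (pi * \<alpha> / 2) * Gamma ((1 - \<alpha>) / 2))) * 2 powr \<alpha>
      = 2 * sqrt pi * Gamma \<alpha>"
    unfolding 4 by (simp add: powr_diff field_simps)
  then have "sqrt pi * (2 * Gamma \<alpha> * cos (pi * \<alpha> / 2))
      = sqrt pi * (sqrt pi * 2 powr \<alpha> * Gamma (\<alpha> / 2) / Gamma ((1 - \<alpha>) / 2))"
    using c g by (simp del: real_sqrt_mult_self add: field_simps)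
  then show ?thesis
    unfolding c_const_def by (simp only: mult_cancel_left) simp
qed

lemma riesz_weight_integral:
  assumes "x \<noteq> 0"
  shows "set_integrable lborel {0<..} (\<lambda>t. t powr ((1 - \<alpha>) / 2 - 1) * exp (- (t * x\<^sup>2)))"
    and "(LINT t:{0<..}|lborel. t powr ((1 - \<alpha>) / 2 - 1) * exp (- (t * x\<^sup>2)))
           = Gamma ((1 - \<alpha>) / 2) * \<bar>x\<bar> powr (\<alpha> - 1)"
proof -
  have *: "(1 - \<alpha>) / 2 > 0" "x\<^sup>2 > 0" using \<alpha> assms by auto
  note G = gamma_integral_scaled(1,2)[OF *]
  show "set_integrable lborel {0<..} (\<lambda>t. t powr ((1 - \<alpha>) / 2 - 1) * exp (- (t * x\<^sup>2)))"
    by (rule G)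
  have "(x\<^sup>2) powr - ((1 - \<alpha>) / 2) = \<bar>x\<bar> powr (\<alpha> - 1)"
    using assms powr_powr[of "\<bar>x\<bar>" 2 "- ((1 - \<alpha>) / 2)"] by (simp add: diff_divide_distrib)
  then show "(LINT t:{0<..}|lborel. t powr ((1 - \<alpha>) / 2 - 1) * exp (- (t * x\<^sup>2)))
           = Gamma ((1 - \<alpha>) / 2) * \<bar>x\<bar> powr (\<alpha> - 1)"
    using G(2) by simp
qed

lemma Gamma_half_pos: "Gamma ((1 - \<alpha>) / 2) > 0"
  using \<alpha> by simp

lemma riesz_weight_nonneg: "0 \<le> riesz_weight \<alpha> n x"
  using truncated_integral(3)[OF riesz_weight_integral(1), of x n] Gamma_half_pos
  by (auto simp: riesz_weight_def)

lemma riesz_weight_mono: "mono (\<lambda>n. riesz_weight \<alpha> n x)"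
  using truncated_integral(1)[OF riesz_weight_integral(1), of x] Gamma_half_pos
  by (auto simp: riesz_weight_def mono_def intro!: divide_right_mono)

lemma riesz_weight_tendsto: "(\<lambda>n. riesz_weight \<alpha> n x) \<longlonglongrightarrow> \<bar>x\<bar> powr (\<alpha> - 1)"
proof (cases "x = 0")
  case False
  have "(\<lambda>n. riesz_weight \<alpha> n x) \<longlonglongrightarrow> Gamma ((1 - \<alpha>) / 2) * \<bar>x\<bar> powr (\<alpha> - 1) / Gamma ((1 - \<alpha>) / 2)"
    using truncated_integral(2)[OF riesz_weight_integral(1)[OF False]] Gamma_half_pos
    unfolding riesz_weight_def riesz_weight_integral(2)[OF False] if_not_P[OF False]
    by (intro tendsto_divide tendsto_const) auto
  then show ?thesis using Gamma_half_pos by simp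
qed (simp add: riesz_weight_def)

lemma riesz_weight_le: "riesz_weight \<alpha> n x \<le> \<bar>x\<bar> powr (\<alpha> - 1)"
  using riesz_weight_mono riesz_weight_tendsto by (rule incseq_le)

lemma borel_measurable_riesz_weight [measurable]: "riesz_weight \<alpha> n \<in> borel_measurable borel"
  unfolding riesz_weight_def set_lebesgue_integral_def by measurable

lemma borel_measurable_riesz_ft [measurable]: "riesz_ft \<alpha> n \<in> borel_measurable borel"
  unfolding riesz_ft_def set_lebesgue_integral_def by measurable

lemma riesz_ft_nonneg: "0 \<le> riesz_ft \<alpha> n u"
  unfolding riesz_ft_def set_lebesgue_integral_def using Gamma_half_pos
  by (intro mult_nonneg_nonneg integral_nonneg_AE) auto

text \<open>The full integral is the Gamma integral with exponent \<alpha>/2 at v = u^2/4. The case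
  u = 0 is excluded because \<open>0 powr - \<alpha>\<close> is 0 while \<open>riesz_ft\<close> is
  positive there; this is why the energy statements below require that coordinates coincide only on
  a null set.\<close>

lemma
  assumes u: "u \<noteq> 0"
  shows riesz_ft_tendsto: "(\<lambda>n. riesz_ft \<alpha> n u) \<longlonglongrightarrow> c_const \<alpha> * \<bar>u\<bar> powr - \<alpha>"
    and riesz_ft_le: "riesz_ft \<alpha> n u \<le> c_const \<alpha> * \<bar>u\<bar> powr - \<alpha>"
proof -
  have *: "\<alpha> / 2 > 0" "u\<^sup>2 / 4 > 0" using \<alpha> u by auto
  note G = gamma_integral_scaled(3,4)[OF *]
  have "(u\<^sup>2 / 4) powr - (\<alpha> / 2) = ((\<bar>u\<bar> / 2) powr 2) powr - (\<alpha> / 2)"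
    using u by (simp add: power_divide)
  also have "\<dots> = \<bar>u\<bar> powr - \<alpha> * 2 powr \<alpha>"
    using u unfolding powr_powr by (simp add: powr_divide powr_minus field_simps)
  finally have c: "sqrt pi / Gamma ((1 - \<alpha>) / 2) * (Gamma (\<alpha> / 2) * (u\<^sup>2 / 4) powr - (\<alpha> / 2))
     = c_const \<alpha> * \<bar>u\<bar> powr - \<alpha>"
    by (simp add: c_const_eq)
  show "(\<lambda>n. riesz_ft \<alpha> n u) \<longlonglongrightarrow> c_const \<alpha> * \<bar>u\<bar> powr - \<alpha>"
    unfolding riesz_ft_def c[symmetric] G(2)[symmetric]
    using truncated_integral(2)[OF G(1)] by (intro tendsto_mult_left) auto
  show "riesz_ft \<alpha> n u \<le> c_const \<alpha> * \<bar>u\<bar> powr - \<alpha>"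
    unfolding riesz_ft_def c[symmetric] G(2)[symmetric]
    using truncated_integral(4)[OF G(1)] Gamma_half_pos by (intro mult_left_mono) auto
qed

text \<open>Fubini in (t, x). Without truncation it would fail, since |x|^(\<alpha>-1) is not
  integrable at infinity; with t > e the integral over x of the absolute value is sqrt pi times
  t^(-\<alpha>/2-1), which is integrable.\<close>

lemma fourier_riesz_weight:
  shows "integrable lborel (riesz_weight \<alpha> n)"
    and "(\<integral>x. iexp (u * x) * complex_of_real (riesz_weight \<alpha> n x) \<partial>lborel) = complex_of_real (riesz_ft \<alpha> n u)"
proof -
  define e :: real where "e = inverse (Suc n)"
  have e: "e > 0" by (simp add: e_def)
  define G where "G = Gamma ((1 - \<alpha>) / 2)"
  have G: "G > 0" using Gamma_half_pos by (simp add: G_def)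
  define F where "F u t x = complex_of_real (indicator {e<..} t * t powr ((1 - \<alpha>) / 2 - 1) * exp (- (t * x\<^sup>2)))
     * iexp (u * x)" for u t x :: real
  have tpow: "t powr ((1 - \<alpha>) / 2 - 1) * sqrt (pi / t) = sqrt pi * t powr (- (\<alpha> / 2) - 1)" if "t > 0" for t
  proof -
    have "t powr ((1 - \<alpha>) / 2 - 1) = t powr (- (\<alpha> / 2) - 1) * t powr (1 / 2)"
      by (simp add: field_simps flip: powr_add)
    then show ?thesis using that by (simp add: real_sqrt_divide powr_half_sqrt)
  qed
  have Fm [measurable]: "case_prod (F u) \<in> borel_measurable (lborel \<Otimes>\<^sub>M lborel)" for u
    unfolding F_def by measurable
  have nF: "norm (F u t x) = indicator {e<..} t * t powr ((1 - \<alpha>) / 2 - 1) * exp (- (t * x\<^sup>2))" for u t x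
    by (simp add: F_def norm_mult abs_mult)
  have inx: "integrable lborel (\<lambda>x. F u t x)" for u t
  proof (cases "t > e")
    case True
    with e have t: "t > 0" by simp
    have "integrable lborel (\<lambda>x. t powr ((1 - \<alpha>) / 2 - 1) * exp (- (t * x\<^sup>2)))"
      using gaussian_fourier(1)[OF t] by simp
    then show ?thesis
      by (rule Bochner_Integration.integrable_bound) (simp add: F_def, simp add: nF True)
  qed (simp add: F_def)
  have Ix: "(\<integral>x. F u t x \<partial>lborel) = complex_of_real (indicator {e<..} t * (sqrt pi * t powr (- (\<alpha> / 2) - 1) * exp (- (u\<^sup>2 / 4 / t))))" for u t
  proof (cases "t > e")
    case True
    with e have t: "t > 0" by simp
    have "(\<integral>x. F u t x \<partial>lborel) = complex_of_real (t powr ((1 - \<alpha>) / 2 - 1)) *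
        (\<integral>x. iexp (u * x) * complex_of_real (exp (- (t * x\<^sup>2))) \<partial>lborel)"
      unfolding F_def using True by (simp add: mult_ac flip: integral_mult_right_zero)
    also have "\<dots> = complex_of_real ((t powr ((1 - \<alpha>) / 2 - 1) * sqrt (pi / t)) * exp (- (u\<^sup>2 / (4 * t))))"
      unfolding gaussian_fourier(2)[OF t] by simp
    finally show ?thesis using True unfolding tpow[OF t] by (simp add: field_simps)
  qed (simp add: F_def)
  \<comment> \<open>The norm of F u is F 0, so the value already found at u = 0 serves as the
    integral of the norm.\<close>
  have In: "(\<integral>x. norm (F u t x) \<partial>lborel) = indicator {e<..} t * (sqrt pi * t powr (- (\<alpha> / 2) - 1))" for u t
  proof -
    have "complex_of_real (\<integral>x. norm (F u t x) \<partial>lborel) = (\<integral>x. F 0 t x \<partial>lborel)"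
      unfolding integral_complex_of_real[symmetric] nF by (simp add: F_def)
    then show ?thesis unfolding Ix by (simp only: of_real_eq_iff) simp
  qed
  have int: "integrable (lborel \<Otimes>\<^sub>M lborel) (case_prod (F u))" for u
  proof (rule lborel_pair.Fubini_integrable)
    have "set_integrable lborel {e<..} (\<lambda>t. t powr (- (\<alpha> / 2) - 1))"
      using \<alpha> e by (intro set_integrable_powr_tail) auto
    then have "integrable lborel (\<lambda>t. sqrt pi * (indicator {e<..} t * t powr (- (\<alpha> / 2) - 1)))"
      unfolding set_integrable_def by (intro integrable_mult_right) simp
    then show "integrable lborel (\<lambda>t. \<integral>x. norm (case (t, x) of (t, x) \<Rightarrow> F u t x) \<partial>lborel)"
      by (simp add: In mult_ac)
    show "AE t in lborel. integrable lborel (\<lambda>x. case (t, x) of (t, x) \<Rightarrow> F u t x)"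
      by (simp add: inx)
  qed measurable
  have Ft: "(\<integral>t. F u t x \<partial>lborel) = G * (iexp (u * x) * complex_of_real (riesz_weight \<alpha> n x))" if "x \<noteq> 0" for u x
  proof -
    have "(\<integral>t. F u t x \<partial>lborel) = complex_of_real (LINT t:{e<..}|lborel. t powr ((1 - \<alpha>) / 2 - 1) * exp (- (t * x\<^sup>2))) * iexp (u * x)"
      unfolding F_def set_lebesgue_integral_def integral_mult_left_zero integral_complex_of_real
      by (simp add: mult_ac)
    then show ?thesis using that G by (simp add: riesz_weight_def G_def e_def)
  qed
  have AE0: "AE x::real in lborel. x \<noteq> 0"
    by (rule AE_lborel_singleton)
  have "integrable lborel (\<lambda>x. \<integral>t. F 0 t x \<partial>lborel)"
    using lborel_pair.integrable_snd[OF int] by simp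
  then have "integrable lborel (\<lambda>x. G * (iexp (0 * x) * complex_of_real (riesz_weight \<alpha> n x)))"
    by (rule integrable_cong_AE_imp) (use AE0 in \<open>auto simp: Ft\<close>)
  then show "integrable lborel (riesz_weight \<alpha> n)"
    using G by (auto dest!: integrable_Re)
  have "G * (\<integral>x. iexp (u * x) * complex_of_real (riesz_weight \<alpha> n x) \<partial>lborel) = (\<integral>x. (\<integral>t. F u t x \<partial>lborel) \<partial>lborel)"
    unfolding integral_mult_right_zero[symmetric]
    by (rule integral_cong_AE) (use AE0 in \<open>auto simp: Ft\<close>)
  also have "\<dots> = (\<integral>t. (\<integral>x. F u t x \<partial>lborel) \<partial>lborel)"
    by (rule lborel_pair.Fubini_integral[OF int])
  also have "\<dots> = complex_of_real (\<integral>t. indicator {e<..} t * (sqrt pi * t powr (- (\<alpha> / 2) - 1) * exp (- (u\<^sup>2 / 4 / t))) \<partial>lborel)"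
    by (simp only: Ix integral_complex_of_real)
  also have "\<dots> = G * complex_of_real (riesz_ft \<alpha> n u)"
    using G unfolding riesz_ft_def set_lebesgue_integral_def
    by (simp add: mult_ac G_def e_def flip: integral_mult_right_zero)
  finally show "(\<integral>x. iexp (u * x) * complex_of_real (riesz_weight \<alpha> n x) \<partial>lborel) = complex_of_real (riesz_ft \<alpha> n u)"
    using G by simp
qed

end

section \<open>A Parseval formula for Riesz energies\<close>

text \<open>The Fourier transform of the image of \<open>M\<close> under \<open>p\<close>, a measure
  on the m-dimensional space. Keeping \<open>M\<close> and \<open>p\<close> apart treats alike a
  measure on the diagonal, with \<open>p\<close> given by \<open>\<lambda>y j. y\<close>, and a
  product measure, with \<open>p\<close> the coordinates.\<close>

definition osc :: "'b measure \<Rightarrow> nat \<Rightarrow> ('b \<Rightarrow> nat \<Rightarrow> real) \<Rightarrow> (nat \<Rightarrow> real) \<Rightarrow> complex" where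
  "osc M m p x = (\<integral>y. iexp (\<Sum>j<m. p y j * x j) \<partial>M)"

section \<open>Measurability of oscillatory integrals and of product weights\<close>

lemma sigma_finite_leb_pow: "sigma_finite_measure (leb_pow m)"
proof -
  interpret product_sigma_finite "\<lambda>_::nat. lborel :: real measure" ..
  show ?thesis by (rule sigma_finite) simp
qed

lemma borel_measurable_iexp_sum:
  fixes p :: "'b \<Rightarrow> nat \<Rightarrow> real"
  assumes "\<And>j. j < m \<Longrightarrow> (\<lambda>y. p y j) \<in> borel_measurable M"
  shows "(\<lambda>(x, y). iexp (\<Sum>j<m. p y j * x j)) \<in> borel_measurable (leb_pow m \<Otimes>\<^sub>M M)"
proof -
  have "(\<lambda>v. \<Sum>j<m. p (snd v) j * fst v j) \<in> borel_measurable (leb_pow m \<Otimes>\<^sub>M M)"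
  proof (intro borel_measurable_sum borel_measurable_times)
    fix j assume j: "j \<in> {..<m}"
    show "(\<lambda>v. p (snd v) j) \<in> borel_measurable (leb_pow m \<Otimes>\<^sub>M M)"
      using assms[of j] j by (intro measurable_compose[OF measurable_snd, of "\<lambda>y. p y j"]) auto
    have "(\<lambda>x. x j) \<in> measurable (leb_pow m) borel"
      using measurable_component_singleton[OF j, of "\<lambda>_. lborel :: real measure"] by simp
    then show "(\<lambda>v. fst v j) \<in> borel_measurable (leb_pow m \<Otimes>\<^sub>M M)"
      by (rule measurable_compose[OF measurable_fst])
  qed
  then show ?thesis unfolding split_beta' by measurable
qed

lemma borel_measurable_osc:
  assumes "finite_measure M" "\<And>j. j < m \<Longrightarrow> (\<lambda>y. p y j) \<in> borel_measurable M"
  shows "osc M m p \<in> borel_measurable (leb_pow m)"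
proof -
  interpret finite_measure M by fact
  show ?thesis unfolding osc_def[abs_def]
    using borel_measurable_lebesgue_integral[OF borel_measurable_iexp_sum[OF assms(2)]]
    by simp
qed

lemma borel_measurable_leb_pow_prod:
  fixes w :: "real \<Rightarrow> 'a :: {real_normed_field, second_countable_topology}"
  assumes [measurable]: "w \<in> borel_measurable borel"
  shows "(\<lambda>x. \<Prod>j<m. w (x j)) \<in> borel_measurable (leb_pow m)"
proof (intro borel_measurable_prod)
  fix j assume j: "j \<in> {..<m}"
  have "(\<lambda>x. x j) \<in> measurable (leb_pow m) borel"
    using measurable_component_singleton[OF j, of "\<lambda>_. lborel :: real measure"] by simp
  then show "(\<lambda>x. w (x j)) \<in> borel_measurable (leb_pow m)" by measurable
qed

text \<open>A product with a conjugate is the transform of the law of the difference p - q under the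
  product measure. Inner products thereby reduce to integrals of a single
  \<open>osc\<close>.\<close>

lemma
  fixes p :: "'b \<Rightarrow> nat \<Rightarrow> real" and q :: "'c \<Rightarrow> nat \<Rightarrow> real"
  assumes "finite_measure M" "\<And>j. j < m \<Longrightarrow> (\<lambda>y. p y j) \<in> borel_measurable M"
    and "finite_measure N" "\<And>j. j < m \<Longrightarrow> (\<lambda>y. q y j) \<in> borel_measurable N"
  shows finite_measure_pair: "finite_measure (M \<Otimes>\<^sub>M N)"
    and borel_measurable_diff_pair: "j < m \<Longrightarrow> (\<lambda>v. p (fst v) j - q (snd v) j) \<in> borel_measurable (M \<Otimes>\<^sub>M N)"
    and osc_mult_cnj: "osc M m p x * cnj (osc N m q x) = osc (M \<Otimes>\<^sub>M N) m (\<lambda>v j. p (fst v) j - q (snd v) j) x"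
proof -
  interpret M: finite_measure M by fact
  interpret N: finite_measure N by fact
  interpret pair_sigma_finite M N ..
  interpret P: finite_measure "M \<Otimes>\<^sub>M N" by (rule finite_measure_pair_measure) fact+
  show "finite_measure (M \<Otimes>\<^sub>M N)" by (rule P.finite_measure_axioms)
  have [measurable]: "(\<lambda>v. p (fst v) j) \<in> borel_measurable (M \<Otimes>\<^sub>M N)"
    "(\<lambda>v. q (snd v) j) \<in> borel_measurable (M \<Otimes>\<^sub>M N)" if "j < m" for j
    using assms(2)[OF that] assms(4)[OF that]
    by (auto intro: measurable_compose[OF measurable_snd, of "\<lambda>y. q y j"] measurable_compose[OF measurable_fst, of "\<lambda>y. p y j"])
  show *: "j < m \<Longrightarrow> (\<lambda>v. p (fst v) j - q (snd v) j) \<in> borel_measurable (M \<Otimes>\<^sub>M N)" for j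
    by measurable
  have "(\<lambda>v. \<Sum>j<m. (p (fst v) j - q (snd v) j) * x j) \<in> borel_measurable (M \<Otimes>\<^sub>M N)"
    using * by (intro borel_measurable_sum borel_measurable_times) auto
  then have m [measurable]: "(\<lambda>v. iexp (\<Sum>j<m. (p (fst v) j - q (snd v) j) * x j)) \<in> borel_measurable (M \<Otimes>\<^sub>M N)"
    by measurable
  have "integrable (M \<Otimes>\<^sub>M N) (\<lambda>v. iexp (\<Sum>j<m. (p (fst v) j - q (snd v) j) * x j))"
    by (rule P.integrable_const_bound[where B = 1]) auto
  from integral_fst'[OF this]
  have "osc (M \<Otimes>\<^sub>M N) m (\<lambda>v j. p (fst v) j - q (snd v) j) x
     = (\<integral>y. (\<integral>z. iexp (\<Sum>j<m. (p y j - q z j) * x j) \<partial>N) \<partial>M)"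
    by (simp add: osc_def)
  also have "\<dots> = (\<integral>y. (\<integral>z. iexp (\<Sum>j<m. p y j * x j) * cnj (iexp (\<Sum>j<m. q z j * x j)) \<partial>N) \<partial>M)"
    by (simp add: exp_cnj left_diff_distrib sum_subtractf right_diff_distrib exp_diff exp_minus divide_inverse)
  also have "\<dots> = (\<integral>y. iexp (\<Sum>j<m. p y j * x j) * cnj (osc N m q x) \<partial>M)"
    by (simp add: osc_def)
  also have "\<dots> = osc M m p x * cnj (osc N m q x)"
    by (simp only: osc_def integral_mult_left_zero)
  finally show "osc M m p x * cnj (osc N m q x) = osc (M \<Otimes>\<^sub>M N) m (\<lambda>v j. p (fst v) j - q (snd v) j) x" ..
qed

text \<open>Fubini between the space variable and \<open>V\<close>. For fixed v the exponential
  splits over the coordinates, and each factor is a one-dimensional transform of the truncated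
  weight.\<close>

lemma osc_riesz_weight:
  fixes r :: "'b \<Rightarrow> nat \<Rightarrow> real"
  assumes \<alpha>: "0 < \<alpha>" "\<alpha> < 1"
  assumes "finite_measure V" and r: "\<And>j. j < m \<Longrightarrow> (\<lambda>y. r y j) \<in> borel_measurable V"
  shows "integrable (leb_pow m) (\<lambda>x. osc V m r x * complex_of_real (\<Prod>j<m. riesz_weight \<alpha> n (x j)))"
    and "(\<integral>x. osc V m r x * complex_of_real (\<Prod>j<m. riesz_weight \<alpha> n (x j)) \<partial>leb_pow m)
      = complex_of_real (\<integral>v. (\<Prod>j<m. riesz_ft \<alpha> n (r v j)) \<partial>V)"
proof -
  note [measurable] = borel_measurable_riesz_weight[OF \<alpha>]
  interpret V: finite_measure V by fact
  interpret P: product_sigma_finite "\<lambda>_::nat. lborel :: real measure" ..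
  interpret L: sigma_finite_measure "leb_pow m" by (rule sigma_finite_leb_pow)
  interpret pair_sigma_finite "leb_pow m" V ..
  define W where "W x = (\<Prod>j<m. riesz_weight \<alpha> n (x j))" for x :: "nat \<Rightarrow> real"
  \<comment> \<open>The modulus of H x v is W x whatever v is, so integrability on the product
    reduces to that of W and finiteness of V.\<close>
  define H where "H x v = iexp (\<Sum>j<m. r v j * x j) * complex_of_real (W x)" for x v
  have [measurable]: "W \<in> borel_measurable (leb_pow m)"
    unfolding W_def by (rule borel_measurable_leb_pow_prod) measurable
  have Hm [measurable]: "case_prod H \<in> borel_measurable (leb_pow m \<Otimes>\<^sub>M V)"
    using borel_measurable_iexp_sum[OF r] unfolding H_def split_beta' by measurable
  have W0: "W x \<ge> 0" for x
    unfolding W_def by (intro prod_nonneg ballI riesz_weight_nonneg[OF \<alpha>])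
  have nH: "norm (H x v) = W x" for x v
    using W0[of x] by (simp add: H_def norm_mult)
  have iW: "integrable (leb_pow m) W"
    unfolding W_def by (rule P.product_integrable_prod) (auto intro: fourier_riesz_weight[OF \<alpha>])
  have int: "integrable (leb_pow m \<Otimes>\<^sub>M V) (case_prod H)"
  proof (rule Fubini_integrable)
    show "integrable (leb_pow m) (\<lambda>x. \<integral>v. norm (case (x, v) of (x, v) \<Rightarrow> H x v) \<partial>V)"
      using iW by (simp add: nH)
    show "AE x in leb_pow m. integrable V (\<lambda>v. case (x, v) of (x, v) \<Rightarrow> H x v)"
    proof (rule AE_I2)
      fix x assume [measurable]: "x \<in> space (leb_pow m)"
      have "H x \<in> borel_measurable V" by measurable
      then show "integrable V (\<lambda>v. case (x, v) of (x, v) \<Rightarrow> H x v)"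
        by (auto intro!: V.integrable_const_bound[where B = "W x"] simp: nH)
    qed
  qed fact
  have oH: "osc V m r x * complex_of_real (W x) = (\<integral>v. H x v \<partial>V)" for x
    by (simp only: osc_def H_def integral_mult_left_zero)
  have Hx: "(\<integral>x. H x v \<partial>leb_pow m) = complex_of_real (\<Prod>j<m. riesz_ft \<alpha> n (r v j))" for v
  proof -
    have "H x v = (\<Prod>j<m. iexp (r v j * x j) * complex_of_real (riesz_weight \<alpha> n (x j)))" for x
      by (simp add: H_def W_def prod.distrib exp_sum sum_distrib_left)
    then have "(\<integral>x. H x v \<partial>leb_pow m) = (\<integral>x. (\<Prod>j<m. iexp (r v j * x j) * complex_of_real (riesz_weight \<alpha> n (x j))) \<partial>leb_pow m)"
      by simp
    also have "\<dots> = (\<Prod>j<m. \<integral>t. iexp (r v j * t) * complex_of_real (riesz_weight \<alpha> n t) \<partial>lborel)"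
    proof (rule P.product_integral_prod)
      fix j
      show "integrable lborel (\<lambda>t. iexp (r v j * t) * complex_of_real (riesz_weight \<alpha> n t))"
        by (rule Bochner_Integration.integrable_bound[OF fourier_riesz_weight(1)[OF \<alpha>, of n]])
           (auto simp: norm_mult)
    qed simp
    also have "\<dots> = (\<Prod>j<m. complex_of_real (riesz_ft \<alpha> n (r v j)))"
      unfolding fourier_riesz_weight(2)[OF \<alpha>] ..
    finally show ?thesis by simp
  qed
  show "integrable (leb_pow m) (\<lambda>x. osc V m r x * complex_of_real (\<Prod>j<m. riesz_weight \<alpha> n (x j)))"
    using integrable_fst[OF int] by (simp add: oH flip: W_def)
  have "(\<integral>x. osc V m r x * complex_of_real (W x) \<partial>leb_pow m) = (\<integral>v. (\<integral>x. H x v \<partial>leb_pow m) \<partial>V)"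
    unfolding oH Fubini_integral[OF int] ..
  also have "\<dots> = complex_of_real (\<integral>v. (\<Prod>j<m. riesz_ft \<alpha> n (r v j)) \<partial>V)"
    by (simp only: Hx integral_complex_of_real)
  finally show "(\<integral>x. osc V m r x * complex_of_real (\<Prod>j<m. riesz_weight \<alpha> n (x j)) \<partial>leb_pow m)
      = complex_of_real (\<integral>v. (\<Prod>j<m. riesz_ft \<alpha> n (r v j)) \<partial>V)"
    unfolding W_def .
qed

text \<open>Dominated convergence: the transforms are nonnegative and lie below their limits, so the
  energy density itself is the majorant.\<close>

lemma riesz_ft_prod_tendsto:
  fixes r :: "'b \<Rightarrow> nat \<Rightarrow> real"
  assumes \<alpha>: "0 < \<alpha>" "\<alpha> < 1"
  assumes r: "\<And>j. j < m \<Longrightarrow> (\<lambda>y. r y j) \<in> borel_measurable V"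
    and nz: "AE v in V. \<forall>j<m. r v j \<noteq> 0"
    and int: "integrable V (\<lambda>v. \<Prod>j<m. \<bar>r v j\<bar> powr - \<alpha>)"
  shows "(\<lambda>n. \<integral>v. (\<Prod>j<m. riesz_ft \<alpha> n (r v j)) \<partial>V)
     \<longlonglongrightarrow> c_const \<alpha> ^ m * (\<integral>v. (\<Prod>j<m. \<bar>r v j\<bar> powr - \<alpha>) \<partial>V)"
proof -
  have e: "c_const \<alpha> ^ m * (\<integral>v. (\<Prod>j<m. \<bar>r v j\<bar> powr - \<alpha>) \<partial>V)
      = (\<integral>v. (\<Prod>j<m. c_const \<alpha> * \<bar>r v j\<bar> powr - \<alpha>) \<partial>V)"
    by (simp add: prod.distrib)
  show ?thesis unfolding e
  proof (rule integral_dominated_convergence[where w = "\<lambda>v. \<Prod>j<m. c_const \<alpha> * \<bar>r v j\<bar> powr - \<alpha>"])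
    show i: "integrable V (\<lambda>v. \<Prod>j<m. c_const \<alpha> * \<bar>r v j\<bar> powr - \<alpha>)"
      using int by (simp add: prod.distrib)
    then show "(\<lambda>v. \<Prod>j<m. c_const \<alpha> * \<bar>r v j\<bar> powr - \<alpha>) \<in> borel_measurable V" by simp
    show "(\<lambda>v. \<Prod>j<m. riesz_ft \<alpha> n (r v j)) \<in> borel_measurable V" for n
      by (intro borel_measurable_prod measurable_compose[OF r borel_measurable_riesz_ft[OF \<alpha>]]) auto
    show "AE v in V. (\<lambda>n. \<Prod>j<m. riesz_ft \<alpha> n (r v j)) \<longlonglongrightarrow> (\<Prod>j<m. c_const \<alpha> * \<bar>r v j\<bar> powr - \<alpha>)"
      using nz by eventually_elim (auto intro!: tendsto_prod riesz_ft_tendsto[OF \<alpha>])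
    show "AE v in V. norm (\<Prod>j<m. riesz_ft \<alpha> n (r v j)) \<le> (\<Prod>j<m. c_const \<alpha> * \<bar>r v j\<bar> powr - \<alpha>)" for n
      using nz by eventually_elim
        (auto simp: abs_prod abs_of_nonneg riesz_ft_nonneg[OF \<alpha>] intro!: prod_mono riesz_ft_le[OF \<alpha>])
  qed
qed

text \<open>Both sides are limits of the truncated identity for the difference map. On the left
  dominated convergence is used, and as the integrand has no sign, its absolute integrability is a
  hypothesis; in the application, square-integrability of the two factors supplies it.\<close>

proposition osc_parseval:
  fixes p :: "'b \<Rightarrow> nat \<Rightarrow> real" and q :: "'c \<Rightarrow> nat \<Rightarrow> real"
  assumes \<alpha>: "0 < \<alpha>" "\<alpha> < 1"
  assumes M: "finite_measure M" "\<And>j. j < m \<Longrightarrow> (\<lambda>y. p y j) \<in> borel_measurable M"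
    and N: "finite_measure N" "\<And>j. j < m \<Longrightarrow> (\<lambda>y. q y j) \<in> borel_measurable N"
    and nz: "AE v in M \<Otimes>\<^sub>M N. \<forall>j<m. p (fst v) j \<noteq> q (snd v) j"
    and int: "integrable (M \<Otimes>\<^sub>M N) (\<lambda>v. \<Prod>j<m. \<bar>p (fst v) j - q (snd v) j\<bar> powr - \<alpha>)"
    and int': "integrable (leb_pow m) (\<lambda>x. osc M m p x * cnj (osc N m q x) * complex_of_real (\<Prod>j<m. \<bar>x j\<bar> powr (\<alpha> - 1)))"
  shows "(\<integral>x. osc M m p x * cnj (osc N m q x) * complex_of_real (\<Prod>j<m. \<bar>x j\<bar> powr (\<alpha> - 1)) \<partial>leb_pow m)
     = complex_of_real (c_const \<alpha> ^ m * (\<integral>v. (\<Prod>j<m. \<bar>p (fst v) j - q (snd v) j\<bar> powr - \<alpha>) \<partial>(M \<Otimes>\<^sub>M N)))"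
proof (rule LIMSEQ_unique)
  let ?V = "M \<Otimes>\<^sub>M N" and ?r = "\<lambda>v j. p (fst v) j - q (snd v) j"
  let ?A = "\<lambda>x. osc M m p x * cnj (osc N m q x)"
  have o: "osc M m p x * cnj (osc N m q x) = osc ?V m ?r x" for x
    by (rule osc_mult_cnj[OF M N])
  have V: "finite_measure ?V"
    by (rule finite_measure_pair[where m = m and p = p and q = q]) fact+
  have r: "(\<lambda>v. ?r v j) \<in> borel_measurable ?V" if "j < m" for j
    by (rule borel_measurable_diff_pair[where m = m]) fact+
  have R: "integrable (leb_pow m) (\<lambda>x. osc M m p x * cnj (osc N m q x) * complex_of_real (\<Prod>j<m. riesz_weight \<alpha> n (x j)))"
    "(\<integral>x. osc M m p x * cnj (osc N m q x) * complex_of_real (\<Prod>j<m. riesz_weight \<alpha> n (x j)) \<partial>leb_pow m)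
      = complex_of_real (\<integral>v. (\<Prod>j<m. riesz_ft \<alpha> n (?r v j)) \<partial>?V)" for n
    unfolding o using osc_riesz_weight[where m = m and r = ?r, OF \<alpha> V r] by blast+
  have "(\<lambda>n. complex_of_real (\<integral>v. (\<Prod>j<m. riesz_ft \<alpha> n (?r v j)) \<partial>?V))
    \<longlonglongrightarrow> complex_of_real (c_const \<alpha> ^ m * (\<integral>v. (\<Prod>j<m. \<bar>?r v j\<bar> powr - \<alpha>) \<partial>?V))"
    by (intro tendsto_of_real riesz_ft_prod_tendsto[OF \<alpha> r]) (use nz int in auto)
  then show "(\<lambda>n. \<integral>x. ?A x * complex_of_real (\<Prod>j<m. riesz_weight \<alpha> n (x j)) \<partial>leb_pow m)
    \<longlonglongrightarrow> complex_of_real (c_const \<alpha> ^ m * (\<integral>v. (\<Prod>j<m. \<bar>?r v j\<bar> powr - \<alpha>) \<partial>?V))"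
    unfolding R(2) .
  show "(\<lambda>n. \<integral>x. ?A x * complex_of_real (\<Prod>j<m. riesz_weight \<alpha> n (x j)) \<partial>leb_pow m)
    \<longlonglongrightarrow> (\<integral>x. ?A x * complex_of_real (\<Prod>j<m. \<bar>x j\<bar> powr (\<alpha> - 1)) \<partial>leb_pow m)"
  proof (rule integral_dominated_convergence[OF _ _ integrable_norm[OF int']])
    show "AE x in leb_pow m. (\<lambda>n. ?A x * complex_of_real (\<Prod>j<m. riesz_weight \<alpha> n (x j)))
      \<longlonglongrightarrow> ?A x * complex_of_real (\<Prod>j<m. \<bar>x j\<bar> powr (\<alpha> - 1))"
      by (intro AE_I2 tendsto_mult_left tendsto_of_real tendsto_prod riesz_weight_tendsto[OF \<alpha>])
    show "AE x in leb_pow m. norm (?A x * complex_of_real (\<Prod>j<m. riesz_weight \<alpha> n (x j)))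
        \<le> norm (?A x * complex_of_real (\<Prod>j<m. \<bar>x j\<bar> powr (\<alpha> - 1)))" for n
      unfolding norm_mult norm_of_real abs_prod
      by (intro AE_I2 mult_left_mono prod_mono)
         (auto simp: abs_of_nonneg riesz_weight_nonneg[OF \<alpha>] intro: riesz_weight_le[OF \<alpha>])
  qed (use int' R(1) in auto)
qed

text \<open>For p = q the integrand is nonnegative and increases along the truncation. Monotone
  convergence then turns finiteness of the energy into integrability of the left side, which here is
  a conclusion.\<close>

proposition osc_plancherel:
  fixes p :: "'b \<Rightarrow> nat \<Rightarrow> real"
  assumes \<alpha>: "0 < \<alpha>" "\<alpha> < 1"
  assumes M: "finite_measure M" "\<And>j. j < m \<Longrightarrow> (\<lambda>y. p y j) \<in> borel_measurable M"
    and nz: "AE v in M \<Otimes>\<^sub>M M. \<forall>j<m. p (fst v) j \<noteq> p (snd v) j"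
    and int: "integrable (M \<Otimes>\<^sub>M M) (\<lambda>v. \<Prod>j<m. \<bar>p (fst v) j - p (snd v) j\<bar> powr - \<alpha>)"
  shows "integrable (leb_pow m) (\<lambda>x. (cmod (osc M m p x))\<^sup>2 * (\<Prod>j<m. \<bar>x j\<bar> powr (\<alpha> - 1)))" (is ?th1)
    and "(\<integral>x. (cmod (osc M m p x))\<^sup>2 * (\<Prod>j<m. \<bar>x j\<bar> powr (\<alpha> - 1)) \<partial>leb_pow m)
     = c_const \<alpha> ^ m * (\<integral>v. (\<Prod>j<m. \<bar>p (fst v) j - p (snd v) j\<bar> powr - \<alpha>) \<partial>(M \<Otimes>\<^sub>M M))" (is ?th2)
proof -
  let ?V = "M \<Otimes>\<^sub>M M" and ?r = "\<lambda>v j. p (fst v) j - p (snd v) j"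
  let ?A = "\<lambda>x. (cmod (osc M m p x))\<^sup>2"
  have o: "osc M m p x * cnj (osc M m p x) = osc ?V m ?r x" for x
    by (rule osc_mult_cnj[OF M M])
  have V: "finite_measure ?V"
    by (rule finite_measure_pair[where m = m and p = p and q = p]) fact+
  have r: "(\<lambda>v. ?r v j) \<in> borel_measurable ?V" if "j < m" for j
    by (rule borel_measurable_diff_pair[where m = m]) fact+
  have R: "integrable (leb_pow m) (\<lambda>x. osc M m p x * cnj (osc M m p x) * complex_of_real (\<Prod>j<m. riesz_weight \<alpha> n (x j)))"
    "(\<integral>x. osc M m p x * cnj (osc M m p x) * complex_of_real (\<Prod>j<m. riesz_weight \<alpha> n (x j)) \<partial>leb_pow m)
      = complex_of_real (\<integral>v. (\<Prod>j<m. riesz_ft \<alpha> n (?r v j)) \<partial>?V)" for n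
    unfolding o using osc_riesz_weight[where m = m and r = ?r, OF \<alpha> V r] by blast+
  have 1: "integrable (leb_pow m) (\<lambda>x. ?A x * (\<Prod>j<m. riesz_weight \<alpha> n (x j)))" for n
    using R(1)[of n] unfolding complex_norm_square[symmetric] of_real_power[symmetric] of_real_mult[symmetric] complex_of_real_integrable_eq .
  have 2: "(\<integral>x. ?A x * (\<Prod>j<m. riesz_weight \<alpha> n (x j)) \<partial>leb_pow m) = (\<integral>v. (\<Prod>j<m. riesz_ft \<alpha> n (?r v j)) \<partial>?V)" for n
    using R(2)[of n] unfolding complex_norm_square[symmetric] of_real_power[symmetric] of_real_mult[symmetric] integral_complex_of_real of_real_eq_iff .
  have lim: "(\<lambda>n. \<integral>x. ?A x * (\<Prod>j<m. riesz_weight \<alpha> n (x j)) \<partial>leb_pow m)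
      \<longlonglongrightarrow> c_const \<alpha> ^ m * (\<integral>v. (\<Prod>j<m. \<bar>?r v j\<bar> powr - \<alpha>) \<partial>?V)"
    unfolding 2 by (intro riesz_ft_prod_tendsto[OF \<alpha> r]) (use nz int in auto)
  have mono: "AE x in leb_pow m. mono (\<lambda>n. ?A x * (\<Prod>j<m. riesz_weight \<alpha> n (x j)))"
    using monoD[OF riesz_weight_mono[OF \<alpha>]]
    by (intro AE_I2 monoI mult_left_mono prod_mono) (auto simp: riesz_weight_nonneg[OF \<alpha>])
  have nn: "AE x in leb_pow m. 0 \<le> ?A x * (\<Prod>j<m. riesz_weight \<alpha> n (x j))" for n
    by (intro AE_I2 mult_nonneg_nonneg prod_nonneg) (auto simp: riesz_weight_nonneg[OF \<alpha>])
  have pl: "AE x in leb_pow m. (\<lambda>n. ?A x * (\<Prod>j<m. riesz_weight \<alpha> n (x j))) \<longlonglongrightarrow> ?A x * (\<Prod>j<m. \<bar>x j\<bar> powr (\<alpha> - 1))"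
    by (intro AE_I2 tendsto_mult_left tendsto_prod riesz_weight_tendsto[OF \<alpha>])
  have [measurable]: "osc M m p \<in> borel_measurable (leb_pow m)"
    "(\<lambda>x. \<Prod>j<m. \<bar>x j\<bar> powr (\<alpha> - 1)) \<in> borel_measurable (leb_pow m)"
    using borel_measurable_osc[OF M] borel_measurable_leb_pow_prod[of "\<lambda>x. \<bar>x\<bar> powr (\<alpha> - 1)" m] by auto
  have ms: "(\<lambda>x. ?A x * (\<Prod>j<m. \<bar>x j\<bar> powr (\<alpha> - 1))) \<in> borel_measurable (leb_pow m)"
    by measurable
  show ?th1 ?th2
    using integral_monotone_convergence_nonneg[OF 1 mono nn pl lim ms] by auto
qed

section \<open>Energies of power weights\<close>

text \<open>Substitute z = yt in the Beta integral: the two powers contribute y^(a+b-2) and the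
  Jacobian one more y.\<close>

lemma nn_integral_Beta_scaled:
  fixes a b y :: real
  assumes a: "a > 0" and b: "b > 0" and y: "y > 0"
  shows "(\<integral>\<^sup>+z. ennreal (indicator {0..y} z * (z powr (a - 1) * (y - z) powr (b - 1))) \<partial>lborel)
     = ennreal (y powr (a + b - 1) * Beta a b)"
proof -
  have B: "(\<integral>\<^sup>+t. ennreal (indicator {0..1} t * (t powr (a - 1) * (1 - t) powr (b - 1))) \<partial>lborel) = ennreal (Beta a b)"
    using nn_integral_has_integral_lebesgue[OF _ has_integral_Beta_real[OF a b]] by simp
  have "(\<integral>\<^sup>+z. ennreal (indicator {0..y} z * (z powr (a - 1) * (y - z) powr (b - 1))) \<partial>lborel)
     = ennreal y * (\<integral>\<^sup>+t. ennreal (indicator {0..y} (0 + y * t) * ((0 + y * t) powr (a - 1) * (y - (0 + y * t)) powr (b - 1))) \<partial>lborel)"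
    using y nn_integral_real_affine[of "\<lambda>z. ennreal (indicator {0..y} z * (z powr (a - 1) * (y - z) powr (b - 1)))" y 0] by simp
  also have "(\<integral>\<^sup>+t. ennreal (indicator {0..y} (0 + y * t) * ((0 + y * t) powr (a - 1) * (y - (0 + y * t)) powr (b - 1))) \<partial>lborel)
     = (\<integral>\<^sup>+t. ennreal (y powr (a + b - 2)) * ennreal (indicator {0..1} t * (t powr (a - 1) * (1 - t) powr (b - 1))) \<partial>lborel)"
  proof (rule nn_integral_cong)
    fix t :: real
    have e: "y - y * t = y * (1 - t)" by (simp add: algebra_simps)
    have "(y * t) powr (a - 1) * (y - y * t) powr (b - 1) = y powr (a + b - 2) * (t powr (a - 1) * (1 - t) powr (b - 1))"
      if "0 \<le> t" "t \<le> 1"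
      using that y powr_add[of y "a - 1" "b - 1"] unfolding e
      by (simp add: powr_mult)
    with e show "ennreal (indicator {0..y} (0 + y * t) * ((0 + y * t) powr (a - 1) * (y - (0 + y * t)) powr (b - 1)))
      = ennreal (y powr (a + b - 2)) * ennreal (indicator {0..1} t * (t powr (a - 1) * (1 - t) powr (b - 1)))"
      using y by (auto simp: indicator_def zero_le_mult_iff mult_le_cancel_left1 ennreal_mult'[symmetric])
  qed
  also have "\<dots> = ennreal (y powr (a + b - 2)) * ennreal (Beta a b)"
    by (subst nn_integral_cmult) (auto simp: B)
  also have "ennreal y * \<dots> = ennreal (y powr (a + b - 1) * Beta a b)"
  proof -
    have "y * y powr (a + b - 2) = y powr (a + b - 1)"
      using y powr_add[of y 1 "a + b - 2"] by simp
    then show ?thesis using y by (simp add: ennreal_mult'[symmetric] mult.assoc[symmetric])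
  qed
  finally show ?thesis .
qed

lemma Beta_real_pos: "Beta a b > 0" if "a > 0" "b > 0" for a b :: real
  using that by (auto simp: Beta_def)

lemma Beta_one_left: "Beta 1 b = 1 / b" if "b > 0" for b :: real
proof -
  have "b \<notin> \<int>\<^sub>\<le>\<^sub>0" using that by auto
  then have "Gamma (1 + b) = b * Gamma b" using Gamma_plus1[of b] by (simp add: add_ac)
  moreover have "Gamma b > 0" using that by simp
  ultimately show ?thesis by (simp add: Beta_def)
qed

lemma nn_integral_powr_01:
  fixes s :: real
  assumes "s > 0"
  shows "(\<integral>\<^sup>+y. ennreal (indicator {0..1} y * y powr (s - 1)) \<partial>lborel) = ennreal (1 / s)"
proof -
  \<comment> \<open>The inserted factor \<open>(1 - y) powr 0\<close> is 1 except at y = 1, where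
    \<open>0 powr 0\<close> is 0; hence the congruence only almost everywhere.\<close>
  have "(\<integral>\<^sup>+y. ennreal (indicator {0..1} y * y powr (s - 1)) \<partial>lborel)
    = (\<integral>\<^sup>+y. ennreal (indicator {0..1} y * (y powr (s - 1) * (1 - y) powr (1 - 1))) \<partial>lborel)"
    using AE_lborel_singleton[of 1] by (intro nn_integral_cong_AE) (auto simp: indicator_def)
  also have "\<dots> = ennreal (Beta s 1)"
    using nn_integral_Beta_scaled[of s 1 1] assms by simp
  finally show ?thesis using assms by (simp add: Beta_commute[of s] Beta_one_left)
qed

text \<open>Carrying the weight y^(-d) in the measure makes the kernel an \<open>osc\<close>. For d
  = 0 this is the uniform distribution on the unit interval; its density takes the value 0 at the
  origin, again because \<open>0 powr 0\<close> is 0.\<close>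

definition powr_measure :: "real \<Rightarrow> real measure" where
  "powr_measure d = density lborel (\<lambda>y. ennreal (indicator {0..1} y * y powr - d))"

lemma sets_powr_measure [simp, measurable_cong]: "sets (powr_measure d) = sets borel"
  by (simp add: powr_measure_def)

lemma space_powr_measure [simp]: "space (powr_measure d) = UNIV"
  by (simp add: powr_measure_def)

lemma nn_integral_powr_measure:
  assumes [measurable]: "f \<in> borel_measurable borel"
  shows "(\<integral>\<^sup>+y. f y \<partial>powr_measure d) = (\<integral>\<^sup>+y. ennreal (indicator {0..1} y * y powr - d) * f y \<partial>lborel)"
  unfolding powr_measure_def by (rule nn_integral_density) auto

lemma emeasure_powr_measure:
  assumes "d < 1"
  shows "emeasure (powr_measure d) UNIV = ennreal (1 / (1 - d))"
  using nn_integral_powr_measure[of "\<lambda>_. 1" d] nn_integral_powr_01[of "1 - d"] assms by simp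

lemma finite_measure_powr_measure: "d < 1 \<Longrightarrow> finite_measure (powr_measure d)"
  by (intro finite_measureI) (simp add: emeasure_powr_measure)

lemma prob_space_powr_measure_0: "prob_space (powr_measure 0)"
  by (intro prob_spaceI) (simp add: emeasure_powr_measure)

text \<open>Reduces almost-everywhere claims to the open interval, away from the endpoints where the
  default values of \<open>powr\<close> interfere.\<close>

lemma AE_powr_measure:
  assumes "AE y in lborel. 0 < y \<longrightarrow> y < 1 \<longrightarrow> P y"
  shows "AE y in powr_measure d. P y"
  unfolding powr_measure_def
  by (subst AE_density) (use assms AE_lborel_singleton[of 0] AE_lborel_singleton[of 1] in \<open>auto elim!: eventually_elim2 simp: indicator_def\<close>)

lemma AE_powr_measure_neq: "AE y in powr_measure d. y \<noteq> c"
  by (rule AE_powr_measure) (use AE_lborel_singleton[of c] in eventually_elim, simp)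

text \<open>The part of the Riesz potential at y due to the mass below y is a Beta integral over
  [0, y]; the support condition z \<le> 1 is automatic there because y \<le> 1.\<close>

lemma nn_integral_powr_diff_below:
  assumes "d < 1" "\<beta> < 1" "0 < y" "y \<le> 1"
  shows "(\<integral>\<^sup>+z. ennreal (indicator {..<y} z * \<bar>y - z\<bar> powr - \<beta>) \<partial>powr_measure d)
     = ennreal (y powr (1 - d - \<beta>) * Beta (1 - d) (1 - \<beta>))"
proof -
  have "(\<integral>\<^sup>+z. ennreal (indicator {..<y} z * \<bar>y - z\<bar> powr - \<beta>) \<partial>powr_measure d)
    = (\<integral>\<^sup>+z. ennreal (indicator {0..y} z * (z powr (1 - d - 1) * (y - z) powr (1 - \<beta> - 1))) \<partial>lborel)"
    by (subst nn_integral_powr_measure, measurable, intro nn_integral_cong)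
       (use assms in \<open>auto simp: indicator_def ennreal_mult'[symmetric]\<close>)
  also have "\<dots> = ennreal (y powr (1 - d - \<beta>) * Beta (1 - d) (1 - \<beta>))"
    using assms by (subst nn_integral_Beta_scaled) (auto simp: algebra_simps)
  finally show ?thesis .
qed

text \<open>By symmetry the energy is twice its part below the diagonal. There the inner integral is
  a Beta value times y^(1-d-\<beta>), and the remaining integral of y^(1-2d-\<beta>) over the unit
  interval is 1/(2-2d-\<beta>). The exponent \<beta> will be \<alpha>m.\<close>

lemma
  assumes d: "d < 1" and \<beta>: "\<beta> < 1" and db: "2 * d + \<beta> < 2"
  defines "P \<equiv> powr_measure d \<Otimes>\<^sub>M powr_measure d"
  shows integrable_powr_diff_pair: "integrable P (\<lambda>v. \<bar>fst v - snd v\<bar> powr - \<beta>)"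
    and integral_powr_diff_pair: "(\<integral>v. \<bar>fst v - snd v\<bar> powr - \<beta> \<partial>P) = 2 * Beta (1 - d) (1 - \<beta>) / (2 - 2 * d - \<beta>)"
proof -
  interpret D: finite_measure "powr_measure d" using d by (rule finite_measure_powr_measure)
  interpret pair_sigma_finite "powr_measure d" "powr_measure d" ..
  define B where "B = Beta (1 - d) (1 - \<beta>)"
  have B: "B > 0" unfolding B_def using d \<beta> by (intro Beta_real_pos) auto
  have sp: "sets P = sets (borel \<Otimes>\<^sub>M borel)"
    unfolding P_def by (intro sets_pair_measure_cong) auto
  have m1: "(\<lambda>v. ennreal (indicator {..<fst v} (snd v) * \<bar>fst v - snd v\<bar> powr - \<beta>)) \<in> borel_measurable P"
    and m2: "(\<lambda>v. ennreal (indicator {..<snd v} (fst v) * \<bar>snd v - fst v\<bar> powr - \<beta>)) \<in> borel_measurable P"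
    unfolding measurable_cong_sets[OF sp refl] indicator_def lessThan_def mem_Collect_eq by measurable
  have low: "(\<integral>\<^sup>+y. \<integral>\<^sup>+z. ennreal (indicator {..<y} z * \<bar>y - z\<bar> powr - \<beta>) \<partial>powr_measure d \<partial>powr_measure d)
     = ennreal (B / (2 - 2 * d - \<beta>))"
  proof -
    have "(\<integral>\<^sup>+y. \<integral>\<^sup>+z. ennreal (indicator {..<y} z * \<bar>y - z\<bar> powr - \<beta>) \<partial>powr_measure d \<partial>powr_measure d)
      = (\<integral>\<^sup>+y. ennreal (y powr (1 - d - \<beta>) * B) \<partial>powr_measure d)"
      by (rule nn_integral_cong_AE, rule AE_powr_measure)
         (auto simp: B_def nn_integral_powr_diff_below[OF d \<beta>])
    also have "\<dots> = (\<integral>\<^sup>+y. ennreal (indicator {0..1} y * y powr - d) * ennreal (y powr (1 - d - \<beta>) * B) \<partial>lborel)"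
      by (rule nn_integral_powr_measure) measurable
    also have "\<dots> = (\<integral>\<^sup>+y. ennreal B * ennreal (indicator {0..1} y * y powr ((2 - 2 * d - \<beta>) - 1)) \<partial>lborel)"
    proof (rule nn_integral_cong)
      fix y :: real
      have "y powr - d * (y powr (1 - d - \<beta>) * B) = B * y powr ((2 - 2 * d - \<beta>) - 1)"
        using powr_add[of y "- d" "1 - d - \<beta>"] by (simp add: algebra_simps)
      then show "ennreal (indicator {0..1} y * y powr - d) * ennreal (y powr (1 - d - \<beta>) * B)
          = ennreal B * ennreal (indicator {0..1} y * y powr ((2 - 2 * d - \<beta>) - 1))"
        using B by (auto simp: indicator_def ennreal_mult'[symmetric])
    qed
    also have "\<dots> = ennreal B * ennreal (1 / (2 - 2 * d - \<beta>))"
      using db by (subst nn_integral_cmult, measurable, subst nn_integral_powr_01) auto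
    finally show ?thesis using B by (simp add: ennreal_mult'[symmetric])
  qed
  \<comment> \<open>Nothing is lost on the diagonal: there the integrand is \<open>0 powr - \<beta> = 0\<close>.\<close>
  have "(\<integral>\<^sup>+v. ennreal (\<bar>fst v - snd v\<bar> powr - \<beta>) \<partial>P)
      = (\<integral>\<^sup>+v. ennreal (indicator {..<fst v} (snd v) * \<bar>fst v - snd v\<bar> powr - \<beta>)
            + ennreal (indicator {..<snd v} (fst v) * \<bar>snd v - fst v\<bar> powr - \<beta>) \<partial>P)"
    by (intro nn_integral_cong) (auto simp: indicator_def abs_minus_commute)
  also have "\<dots> = (\<integral>\<^sup>+v. ennreal (indicator {..<fst v} (snd v) * \<bar>fst v - snd v\<bar> powr - \<beta>) \<partial>P)
            + (\<integral>\<^sup>+v. ennreal (indicator {..<snd v} (fst v) * \<bar>snd v - fst v\<bar> powr - \<beta>) \<partial>P)"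
    by (rule nn_integral_add[OF m1 m2])
  also have "(\<integral>\<^sup>+v. ennreal (indicator {..<fst v} (snd v) * \<bar>fst v - snd v\<bar> powr - \<beta>) \<partial>P)
     = ennreal (B / (2 - 2 * d - \<beta>))"
    unfolding low[symmetric] P_def
    using D.nn_integral_fst[OF m1[unfolded P_def]] by simp
  also have "(\<integral>\<^sup>+v. ennreal (indicator {..<snd v} (fst v) * \<bar>snd v - fst v\<bar> powr - \<beta>) \<partial>P)
     = ennreal (B / (2 - 2 * d - \<beta>))"
    unfolding low[symmetric] P_def
    using nn_integral_snd[OF m2[unfolded P_def]] by simp
  also have "ennreal (B / (2 - 2 * d - \<beta>)) + ennreal (B / (2 - 2 * d - \<beta>)) = ennreal (2 * B / (2 - 2 * d - \<beta>))"
    using B db by (simp add: ennreal_plus[symmetric] del: ennreal_plus)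
  finally have "(\<integral>\<^sup>+v. ennreal (\<bar>fst v - snd v\<bar> powr - \<beta>) \<partial>P) = ennreal (2 * B / (2 - 2 * d - \<beta>))" .
  moreover have "(\<lambda>v. \<bar>fst v - snd v\<bar> powr - \<beta>) \<in> borel_measurable P"
    unfolding measurable_cong_sets[OF sp refl] by measurable
  ultimately have "integrable P (\<lambda>v. \<bar>fst v - snd v\<bar> powr - \<beta>) \<and> (\<integral>v. \<bar>fst v - snd v\<bar> powr - \<beta> \<partial>P) = 2 * B / (2 - 2 * d - \<beta>)"
    using B db by (subst nn_integral_eq_integrable[symmetric]) auto
  then show "integrable P (\<lambda>v. \<bar>fst v - snd v\<bar> powr - \<beta>)"
    and "(\<integral>v. \<bar>fst v - snd v\<bar> powr - \<beta> \<partial>P) = 2 * Beta (1 - d) (1 - \<beta>) / (2 - 2 * d - \<beta>)"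
    unfolding B_def by auto
qed

lemma AE_powr_measure_pair_neq:
  assumes "d < 1" shows "AE v in powr_measure d \<Otimes>\<^sub>M powr_measure d. fst v \<noteq> snd v"
proof -
  interpret finite_measure "powr_measure d" using assms by (rule finite_measure_powr_measure)
  interpret pair_sigma_finite "powr_measure d" "powr_measure d" ..
  show ?thesis
  proof (rule AE_pair_measure)
    show "AE x in powr_measure d. AE y in powr_measure d. fst (x, y) \<noteq> snd (x, y)"
      using AE_powr_measure_neq by (auto simp: eq_commute)
  qed measurable
qed

text \<open>Absorbing the two weights into the measures identifies \<open>I_const\<close> as an
  energy, to which the closed form above applies.\<close>

lemma I_const_eq_pair:
  assumes "d < 1"
  shows "I_const m \<alpha> d = (\<integral>v. \<bar>fst v - snd v\<bar> powr - (\<alpha> * real m) \<partial>(powr_measure d \<Otimes>\<^sub>M powr_measure d))"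
proof -
  have fin: "finite_measure (powr_measure d)" using assms by (rule finite_measure_powr_measure)
  have "powr_measure d \<Otimes>\<^sub>M powr_measure d = density (lborel \<Otimes>\<^sub>M lborel)
     (\<lambda>(y, z). ennreal (indicator {0..1} y * y powr - d) * ennreal (indicator {0..1} z * z powr - d))"
    unfolding powr_measure_def
    by (rule pair_measure_density)
       (use fin in \<open>auto simp: powr_measure_def lborel.sigma_finite_measure_axioms finite_measure_def\<close>)
  also have "\<dots> = density (lborel \<Otimes>\<^sub>M lborel) (\<lambda>v. ennreal ((indicator {0..1} (fst v) * fst v powr - d) * (indicator {0..1} (snd v) * snd v powr - d)))"
    by (simp add: split_beta' ennreal_mult')
  finally have P: "powr_measure d \<Otimes>\<^sub>M powr_measure d = \<dots>" .
  have "(\<integral>v. \<bar>fst v - snd v\<bar> powr - (\<alpha> * real m) \<partial>(powr_measure d \<Otimes>\<^sub>M powr_measure d))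
    = (\<integral>v. ((indicator {0..1} (fst v) * fst v powr - d) * (indicator {0..1} (snd v) * snd v powr - d)) *\<^sub>R \<bar>fst v - snd v\<bar> powr - (\<alpha> * real m) \<partial>(lborel \<Otimes>\<^sub>M lborel))"
    unfolding P by (rule integral_density) auto
  also have "\<dots> = I_const m \<alpha> d"
    unfolding I_const_def lborel_prod set_lebesgue_integral_def
    by (rule Bochner_Integration.integral_cong) (auto simp: indicator_times)
  finally show ?thesis ..
qed


section \<open>Mutual energy of a power weight on the diagonal and the uniform measure on the
  cube\<close>

lemma nn_integral_powr_measure_0_reflect:
  assumes [measurable]: "f \<in> borel_measurable borel"
  shows "(\<integral>\<^sup>+z. f (1 - z) \<partial>powr_measure 0) = (\<integral>\<^sup>+z. f z \<partial>powr_measure 0)"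
proof -
  have "(\<integral>\<^sup>+z. f z \<partial>powr_measure 0) = (\<integral>\<^sup>+z. ennreal (indicator {0..1} z * z powr - 0) * f z \<partial>lborel)"
    by (rule nn_integral_powr_measure) measurable
  also have "\<dots> = (\<integral>\<^sup>+z. ennreal (indicator {0..1} (1 - z) * (1 - z) powr - 0) * f (1 - z) \<partial>lborel)"
    using nn_integral_real_affine[of "\<lambda>z. ennreal (indicator {0..1} z * z powr - 0) * f z" "-1" 1] by simp
  also have "\<dots> = (\<integral>\<^sup>+z. ennreal (indicator {0..1} z * z powr - 0) * f (1 - z) \<partial>lborel)"
  \<comment> \<open>The density of the uniform measure and its reflection differ at the endpoints 0
    and 1, where \<open>0 powr 0\<close> is 0.\<close>
  proof (rule nn_integral_cong_AE)
    show "AE z in lborel. ennreal (indicator {0..1} (1 - z) * (1 - z) powr - 0) * f (1 - z)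
        = ennreal (indicator {0..1} z * z powr - 0) * f (1 - z)"
      using AE_lborel_singleton[of 0] AE_lborel_singleton[of 1]
      by eventually_elim (auto simp: indicator_def)
  qed
  also have "\<dots> = (\<integral>\<^sup>+z. f (1 - z) \<partial>powr_measure 0)"
    by (rule nn_integral_powr_measure[symmetric]) measurable
  finally show ?thesis ..
qed

text \<open>Split at z = y. The part above y becomes, by the reflection z to 1 - z, the part below 1
  - y, so one computation serves both sides.\<close>

lemma has_bochner_integral_powr_diff:
  assumes \<alpha>: "\<alpha> < 1" and y: "0 < y" "y < 1"
  shows "has_bochner_integral (powr_measure 0) (\<lambda>z. \<bar>y - z\<bar> powr - \<alpha>) ((y powr (1 - \<alpha>) + (1 - y) powr (1 - \<alpha>)) / (1 - \<alpha>))"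
proof -
  have *: "(\<integral>\<^sup>+z. ennreal (indicator {..<y} z * \<bar>y - z\<bar> powr - \<alpha>) \<partial>powr_measure 0) = ennreal (y powr (1 - \<alpha>) / (1 - \<alpha>))"
    if "0 < y" "y < 1" for y
    using nn_integral_powr_diff_below[of 0 \<alpha> y] that \<alpha> by (simp add: Beta_one_left)
  have "(\<integral>\<^sup>+z. ennreal (\<bar>y - z\<bar> powr - \<alpha>) \<partial>powr_measure 0)
      = (\<integral>\<^sup>+z. ennreal (indicator {..<y} z * \<bar>y - z\<bar> powr - \<alpha>) + ennreal (indicator {..<1 - y} (1 - z) * \<bar>(1 - y) - (1 - z)\<bar> powr - \<alpha>) \<partial>powr_measure 0)"
    by (intro nn_integral_cong) (auto simp: indicator_def abs_minus_commute)
  also have "\<dots> = (\<integral>\<^sup>+z. ennreal (indicator {..<y} z * \<bar>y - z\<bar> powr - \<alpha>) \<partial>powr_measure 0)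
      + (\<integral>\<^sup>+z. ennreal (indicator {..<1 - y} (1 - z) * \<bar>(1 - y) - (1 - z)\<bar> powr - \<alpha>) \<partial>powr_measure 0)"
    by (intro nn_integral_add) measurable
  also have "(\<integral>\<^sup>+z. ennreal (indicator {..<1 - y} (1 - z) * \<bar>(1 - y) - (1 - z)\<bar> powr - \<alpha>) \<partial>powr_measure 0)
      = (\<integral>\<^sup>+z. ennreal (indicator {..<1 - y} z * \<bar>(1 - y) - z\<bar> powr - \<alpha>) \<partial>powr_measure 0)"
    by (rule nn_integral_powr_measure_0_reflect) measurable
  also have "(\<integral>\<^sup>+z. ennreal (indicator {..<y} z * \<bar>y - z\<bar> powr - \<alpha>) \<partial>powr_measure 0) + \<dots>
      = ennreal ((y powr (1 - \<alpha>) + (1 - y) powr (1 - \<alpha>)) / (1 - \<alpha>))"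
    using y \<alpha> by (simp add: * add_divide_distrib)
  finally show ?thesis
    using \<alpha> by (intro has_bochner_integral_nn_integral) auto
qed

lemma has_bochner_integral_powr_measure_Beta:
  assumes "d - p < 1" "q > -1"
  shows "has_bochner_integral (powr_measure d) (\<lambda>y. y powr p * (1 - y) powr q) (Beta (1 - d + p) (1 + q))"
proof (rule has_bochner_integral_nn_integral)
  have "(\<integral>\<^sup>+y. ennreal (y powr p * (1 - y) powr q) \<partial>powr_measure d)
    = (\<integral>\<^sup>+y. ennreal (indicator {0..1} y * y powr - d) * ennreal (y powr p * (1 - y) powr q) \<partial>lborel)"
    by (rule nn_integral_powr_measure) measurable
  also have "\<dots> = (\<integral>\<^sup>+y. ennreal (indicator {0..1} y * (y powr ((1 - d + p) - 1) * (1 - y) powr ((1 + q) - 1))) \<partial>lborel)"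
  proof (rule nn_integral_cong)
    fix y :: real
    show "ennreal (indicator {0..1} y * y powr - d) * ennreal (y powr p * (1 - y) powr q)
        = ennreal (indicator {0..1} y * (y powr ((1 - d + p) - 1) * (1 - y) powr ((1 + q) - 1)))"
      using powr_add[of y "- d" p] by (auto simp: indicator_def ennreal_mult'[symmetric])
  qed
  also have "\<dots> = ennreal (Beta (1 - d + p) (1 + q))"
    using assms by (subst nn_integral_Beta_scaled) auto
  finally show "(\<integral>\<^sup>+y. ennreal (y powr p * (1 - y) powr q) \<partial>powr_measure d) = ennreal (Beta (1 - d + p) (1 + q))" .
  show "0 \<le> Beta (1 - d + p) (1 + q)"
    using assms by (intro less_imp_le Beta_real_pos) auto
  show "AE y in powr_measure d. 0 \<le> y powr p * (1 - y) powr q" by auto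
qed measurable

text \<open>Binomial expansion with one Beta integral per term; this is the origin of the sum in
  \<open>L_const\<close>. At the endpoints the expansion can fail, as its terms then contain
  \<open>0 powr 0\<close>.\<close>

lemma has_bochner_integral_powr_sum_power:
  assumes "d < 1" "a > 0"
  shows "has_bochner_integral (powr_measure d) (\<lambda>y. (y powr a + (1 - y) powr a) ^ m)
    (\<Sum>k=0..m. real (m choose k) * Beta (1 - d + a * real k) (1 + a * real (m - k)))"
proof -
  let ?f = "\<lambda>y. \<Sum>k=0..m. real (m choose k) * (y powr (a * real k) * (1 - y) powr (a * real (m - k)))"
  have "has_bochner_integral (powr_measure d) ?f
    (\<Sum>k=0..m. real (m choose k) * Beta (1 - d + a * real k) (1 + a * real (m - k)))"
  proof (intro has_bochner_integral_sum has_bochner_integral_mult_right has_bochner_integral_powr_measure_Beta)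
    fix k
    have "a * real k \<ge> 0" "a * real (m - k) \<ge> 0" using assms by simp_all
    then show "d - a * real k < 1" "-1 < a * real (m - k)" using assms(1) by linarith+
  qed
  then show ?thesis
  proof (rule has_bochner_integral_cong_AE[THEN iffD1, rotated -1])
    show "AE y in powr_measure d. ?f y = (y powr a + (1 - y) powr a) ^ m"
      by (rule AE_powr_measure)
        (auto simp: binomial_ring powr_power atLeast0AtMost mult_ac intro!: AE_I2 sum.cong)
  qed measurable
qed

text \<open>Given y, the coordinates z_j are independent and uniform, so the inner integral is the
  m-th power of the uniform potential at y. Integrating that power against y^(-d) gives the binomial
  sum of Beta values.\<close>

lemma
  fixes m :: nat and d \<alpha> :: real
  assumes d: "d < 1" and \<alpha>: "\<alpha> < 1"
  defines "N \<equiv> Pi\<^sub>M {..<m} (\<lambda>_. powr_measure 0)"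
  shows finite_measure_PiM_powr_measure_0: "finite_measure N"
    and AE_powr_measure_PiM_neq: "AE v in powr_measure d \<Otimes>\<^sub>M N. \<forall>j<m. fst v \<noteq> snd v j"
    and has_bochner_integral_powr_measure_PiM:
      "has_bochner_integral (powr_measure d \<Otimes>\<^sub>M N) (\<lambda>v. \<Prod>j<m. \<bar>fst v - snd v j\<bar> powr - \<alpha>)
        ((\<Sum>k=0..m. real (m choose k) * Beta (1 - d + (1 - \<alpha>) * real k) (1 + (1 - \<alpha>) * real (m - k))) / (1 - \<alpha>) ^ m)"
proof -
  interpret D: finite_measure "powr_measure d" using d by (rule finite_measure_powr_measure)
  interpret p0: prob_space "powr_measure 0" by (rule prob_space_powr_measure_0)
  interpret P: product_prob_space "\<lambda>_::nat. powr_measure 0" "{..<m}" ..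
  interpret N: prob_space N unfolding N_def by (rule P.P.prob_space_axioms)
  interpret pair_sigma_finite "powr_measure d" N ..
  show "finite_measure N" by (rule N.finite_measure_axioms)
  have mj [measurable]: "(\<lambda>v. snd v j) \<in> borel_measurable (powr_measure d \<Otimes>\<^sub>M N)" if "j < m" for j
  proof -
    have "(\<lambda>z. z j) \<in> measurable N (powr_measure 0)"
      unfolding N_def using that by (intro measurable_component_singleton) auto
    then have "(\<lambda>z. z j) \<in> borel_measurable N" by (simp cong: measurable_cong_sets)
    then show ?thesis by (rule measurable_compose[OF measurable_snd])
  qed
  have "AE v in powr_measure d \<Otimes>\<^sub>M N. fst v \<noteq> snd v j" if j: "j < m" for j
  proof (rule AE_pair_measure)
    show "{v \<in> space (powr_measure d \<Otimes>\<^sub>M N). fst v \<noteq> snd v j} \<in> sets (powr_measure d \<Otimes>\<^sub>M N)"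
      using mj[OF j] by measurable
    \<comment> \<open>A single coordinate of the product measure has the uniform law, which has no
      atoms.\<close>
    have "AE z in N. z j \<noteq> y" for y
      unfolding N_def by (rule AE_PiM_component) (use j AE_powr_measure_neq prob_space_powr_measure_0 in auto)
    then show "AE y in powr_measure d. AE z in N. fst (y, z) \<noteq> snd (y, z) j"
      by (auto simp: eq_commute)
  qed
  then have "AE v in powr_measure d \<Otimes>\<^sub>M N. \<forall>j\<in>{..<m}. fst v \<noteq> snd v j"
    by (intro AE_ball_countable[THEN iffD2]) auto
  then show "AE v in powr_measure d \<Otimes>\<^sub>M N. \<forall>j<m. fst v \<noteq> snd v j"
    by eventually_elim auto
  let ?f = "\<lambda>v. \<Prod>j<m. \<bar>fst v - snd v j\<bar> powr - \<alpha>"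
  let ?g = "\<lambda>y. (y powr (1 - \<alpha>) + (1 - y) powr (1 - \<alpha>)) ^ m / (1 - \<alpha>) ^ m"
  have fm: "?f \<in> borel_measurable (powr_measure d \<Otimes>\<^sub>M N)"
  proof (intro borel_measurable_prod)
    fix j assume "j \<in> {..<m}"
    then have [measurable]: "(\<lambda>v. snd v j) \<in> borel_measurable (powr_measure d \<Otimes>\<^sub>M N)"
      by (intro mj) simp
    show "(\<lambda>v. \<bar>fst v - snd v j\<bar> powr - \<alpha>) \<in> borel_measurable (powr_measure d \<Otimes>\<^sub>M N)"
      by measurable
  qed
  \<comment> \<open>The uniform potential was computed for 0 < y < 1 only, and almost every y
    satisfies this.\<close>
  have inner: "integrable N (\<lambda>z. ?f (y, z)) \<and> (\<integral>z. ?f (y, z) \<partial>N) = ?g y" if "0 < y" "y < 1" for y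
    using P.product_integrable_prod[of "{..<m}" "\<lambda>_ z. \<bar>y - z\<bar> powr - \<alpha>"]
      P.product_integral_prod[of "{..<m}" "\<lambda>_ z. \<bar>y - z\<bar> powr - \<alpha>"]
      has_bochner_integral_powr_diff[OF \<alpha> that]
    by (auto simp: N_def has_bochner_integral_iff power_divide)
  have ae: "AE y in powr_measure d. integrable N (\<lambda>z. ?f (y, z)) \<and> (\<integral>z. ?f (y, z) \<partial>N) = ?g y"
    by (rule AE_powr_measure) (use inner in auto)
  have g: "has_bochner_integral (powr_measure d) ?g
     ((\<Sum>k=0..m. real (m choose k) * Beta (1 - d + (1 - \<alpha>) * real k) (1 + (1 - \<alpha>) * real (m - k))) / (1 - \<alpha>) ^ m)"
    using \<alpha> by (intro has_bochner_integral_divide has_bochner_integral_powr_sum_power d) auto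
  have [measurable]: "(\<lambda>y. \<integral>z. ?f (y, z) \<partial>N) \<in> borel_measurable (powr_measure d)"
    using fm by (intro N.borel_measurable_lebesgue_integral) (auto simp: split_beta')
  have int: "integrable (powr_measure d \<Otimes>\<^sub>M N) ?f"
  proof (rule Fubini_integrable[OF fm])
    have "integrable (powr_measure d) (\<lambda>y. \<integral>z. ?f (y, z) \<partial>N)"
      using g ae by (subst integrable_cong_AE[where g = ?g]) (auto simp: has_bochner_integral_iff)
    then show "integrable (powr_measure d) (\<lambda>y. \<integral>z. norm (?f (y, z)) \<partial>N)"
      by (simp add: abs_prod)
    show "AE y in powr_measure d. integrable N (\<lambda>z. ?f (y, z))"
      using ae by auto
  qed
  have "(\<integral>v. ?f v \<partial>(powr_measure d \<Otimes>\<^sub>M N)) = (\<integral>y. (\<integral>z. ?f (y, z) \<partial>N) \<partial>powr_measure d)"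
    using integral_fst'[OF int] by simp
  also have "\<dots> = (\<integral>y. ?g y \<partial>powr_measure d)"
    by (rule integral_cong_AE) (use ae in auto)
  finally show "has_bochner_integral (powr_measure d \<Otimes>\<^sub>M N) (\<lambda>v. \<Prod>j<m. \<bar>fst v - snd v j\<bar> powr - \<alpha>)
        ((\<Sum>k=0..m. real (m choose k) * Beta (1 - d + (1 - \<alpha>) * real k) (1 + (1 - \<alpha>) * real (m - k))) / (1 - \<alpha>) ^ m)"
    using int g by (simp add: has_bochner_integral_iff)
qed

section \<open>The kernel and the test function\<close>

lemma L2_space_mult_cnj_integrable:
  assumes "f \<in> L2_space M" "g \<in> L2_space M"
  shows "integrable M (\<lambda>x. f x * cnj (g x))"
proof (rule Bochner_Integration.integrable_bound)
  show "integrable M (\<lambda>x. (cmod (f x))\<^sup>2 + (cmod (g x))\<^sup>2)"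
    using assms by (auto simp: L2_space_def)
  have "g \<in> borel_measurable M" "f \<in> borel_measurable M"
    using assms by (auto simp: L2_space_def)
  then show "(\<lambda>x. f x * cnj (g x)) \<in> borel_measurable M"
    by (intro borel_measurable_times measurable_compose[OF _ borel_measurable_continuous_onI[of cnj]])
       (auto intro: continuous_intros)
  have "cmod a * cmod b \<le> (cmod a)\<^sup>2 + (cmod b)\<^sup>2" for a b
    using sum_squares_bound[of "cmod a" "cmod b"] mult_nonneg_nonneg[OF norm_ge_zero[of a] norm_ge_zero[of b]] by linarith
  then show "AE x in M. norm (f x * cnj (g x)) \<le> norm ((cmod (f x))\<^sup>2 + (cmod (g x))\<^sup>2)"
    by (auto simp: norm_mult)
qed

text \<open>Cauchy--Schwarz through the pointwise bound |fg| \<le> |f|^2/(2a) + a|g|^2/2, weighted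
  so that each term integrates to at most a/2.\<close>

lemma re_inner_le:
  assumes "f \<in> L2_space M" "g \<in> L2_space M" and a: "a > 0"
    and f: "(\<integral>x. (cmod (f x))\<^sup>2 \<partial>M) \<le> a\<^sup>2" and g: "(\<integral>x. (cmod (g x))\<^sup>2 \<partial>M) \<le> 1"
  shows "\<bar>re_inner M f g\<bar> \<le> a"
proof -
  have i: "integrable M (\<lambda>x. (cmod (f x))\<^sup>2)" "integrable M (\<lambda>x. (cmod (g x))\<^sup>2)"
    using assms by (auto simp: L2_space_def)
  note fg = L2_space_mult_cnj_integrable[OF assms(1,2)]
  have "\<bar>re_inner M f g\<bar> \<le> cmod (\<integral>x. f x * cnj (g x) \<partial>M)"
    unfolding re_inner_def by (rule abs_Re_le_cmod)
  also have "\<dots> \<le> (\<integral>x. cmod (f x * cnj (g x)) \<partial>M)"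
    by (rule integral_norm_bound)
  also have "\<dots> \<le> (\<integral>x. (cmod (f x))\<^sup>2 / (2 * a) + a * (cmod (g x))\<^sup>2 / 2 \<partial>M)"
  proof (rule integral_mono)
    show "integrable M (\<lambda>x. cmod (f x * cnj (g x)))" using fg by (rule integrable_norm)
    show "integrable M (\<lambda>x. (cmod (f x))\<^sup>2 / (2 * a) + a * (cmod (g x))\<^sup>2 / 2)" using i by auto
    show "cmod (f x * cnj (g x)) \<le> (cmod (f x))\<^sup>2 / (2 * a) + a * (cmod (g x))\<^sup>2 / 2" for x
      using a sum_squares_bound[of "cmod (f x)" "a * cmod (g x)"]
      by (simp add: norm_mult field_simps power2_eq_square)
  qed
  also have "\<dots> = (\<integral>x. (cmod (f x))\<^sup>2 \<partial>M) / (2 * a) + a * (\<integral>x. (cmod (g x))\<^sup>2 \<partial>M) / 2"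
    using i by simp
  also have "\<dots> \<le> a\<^sup>2 / (2 * a) + a * 1 / 2"
    using f g a by (intro add_mono divide_right_mono mult_left_mono) auto
  also have "\<dots> = a" using a by (simp add: power2_eq_square)
  finally show ?thesis .
qed

lemma HR_norm_eq:
  assumes "h \<in> HR" shows "HR_norm h = sqrt (\<integral>x. (cmod (h x))\<^sup>2 \<partial>lborel)"
proof -
  have "(\<integral>x. h x * cnj (h x) \<partial>lborel) = complex_of_real (\<integral>x. (cmod (h x))\<^sup>2 \<partial>lborel)"
    by (simp only: complex_norm_square[symmetric] of_real_power[symmetric] integral_complex_of_real)
  then show ?thesis by (simp add: HR_norm_def re_inner_def)
qed

lemma
  assumes \<xi>: "\<xi> \<in> L2_space lborel"
  shows tensor_power_L2: "tensor_power m \<xi> \<in> L2_space (leb_pow m)"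
    and integral_tensor_power: "(\<integral>x. (cmod (tensor_power m \<xi> x))\<^sup>2 \<partial>leb_pow m) = (\<integral>x. (cmod (\<xi> x))\<^sup>2 \<partial>lborel) ^ m"
proof -
  interpret product_sigma_finite "\<lambda>_::nat. lborel :: real measure" ..
  have e: "(cmod (tensor_power m \<xi> x))\<^sup>2 = (\<Prod>j<m. (cmod (\<xi> (x j)))\<^sup>2)" for x
    by (simp add: tensor_power_def prod_norm[symmetric] prod_power_distrib)
  have i: "integrable lborel (\<lambda>x. (cmod (\<xi> x))\<^sup>2)" and "\<xi> \<in> borel_measurable borel"
    using \<xi> by (auto simp: L2_space_def)
  then have "tensor_power m \<xi> \<in> borel_measurable (leb_pow m)"
    unfolding tensor_power_def[abs_def] by (intro borel_measurable_leb_pow_prod)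
  moreover have "integrable (leb_pow m) (\<lambda>x. (cmod (tensor_power m \<xi> x))\<^sup>2)"
    unfolding e using i by (intro product_integrable_prod) auto
  ultimately show "tensor_power m \<xi> \<in> L2_space (leb_pow m)" by (simp add: L2_space_def)
  show "(\<integral>x. (cmod (tensor_power m \<xi> x))\<^sup>2 \<partial>leb_pow m) = (\<integral>x. (cmod (\<xi> x))\<^sup>2 \<partial>lborel) ^ m"
    unfolding e using i by (subst product_integral_prod) auto
qed

lemma integral_powr_measure:
  fixes f :: "real \<Rightarrow> complex"
  assumes [measurable]: "f \<in> borel_measurable borel"
  shows "(\<integral>y. f y \<partial>powr_measure d) = (LINT y:{0..1}|lborel. complex_of_real (y powr - d) * f y)"
proof -
  have "(\<integral>y. f y \<partial>powr_measure d) = (\<integral>y. (indicator {0..1} y * y powr - d) *\<^sub>R f y \<partial>lborel)"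
    unfolding powr_measure_def by (rule integral_density) auto
  then show ?thesis
    by (simp add: set_lebesgue_integral_def scaleR_conv_of_real mult.assoc)
qed

text \<open>The phase depends on x only through the sum of its coordinates, so the kernel comes from
  the measure y^(-d) dy placed on the diagonal of the cube.\<close>

lemma Q1_eq_osc:
  "Q1 \<epsilon> m \<alpha> d x = complex_of_real (C_const \<epsilon> m \<alpha> d) * osc (powr_measure d) m (\<lambda>y j. y) x
     * complex_of_real (\<Prod>j<m. \<bar>x j\<bar> powr ((\<alpha> - 1) / 2))"
  unfolding Q1_def osc_def by (subst integral_powr_measure) (auto simp: sum_distrib_left)

lemma powr_half_square: "(x powr (b / 2))\<^sup>2 = x powr b" for x b :: real
  using powr_add[of x "b / 2" "b / 2"] by (simp add: power2_eq_square)

lemma prod_powr_half_square: "(\<Prod>j<m. \<bar>x j\<bar> powr (b / 2))\<^sup>2 = (\<Prod>j<m. \<bar>x j\<bar> powr b)" for b :: real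
  by (simp only: prod_power_distrib powr_half_square)

text \<open>The constant normalises the function: 2/((1-\<alpha>)(2-\<alpha>)) is
  \<open>I_const 1 \<alpha> 0\<close>, the Riesz energy of the uniform measure on the unit interval,
  and its product with \<open>c_const \<alpha>\<close> is the squared norm before scaling.\<close>

definition riesz_test :: "real \<Rightarrow> real \<Rightarrow> complex" where
  "riesz_test \<alpha> x = complex_of_real ((c_const \<alpha> * (2 / ((1 - \<alpha>) * (2 - \<alpha>)))) powr (- 1 / 2))
     * (\<integral>y. iexp (y * x) \<partial>powr_measure 0) * complex_of_real (\<bar>x\<bar> powr ((\<alpha> - 1) / 2))"

section \<open>Norm of the kernel, and its value at the normalised test function\<close>

context
  fixes \<alpha> :: real
  assumes \<alpha>: "0 < \<alpha>" "\<alpha> < 1"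
begin

lemma c_const_pos: "c_const \<alpha> > 0"
  using \<alpha> Gamma_half_pos[OF \<alpha>] by (auto simp: c_const_eq[OF \<alpha>])

text \<open>On the diagonal all m differences agree, so the product of Riesz kernels collapses to
  the single power |y-z|^(-\<alpha>m), whose energy is known. \<open>osc_plancherel\<close> converts
  it into the weighted L2 norm.\<close>

lemma
  assumes m: "m > 0" and d: "d < 1" "\<alpha> * real m < 1" "2 * d + \<alpha> * real m < 2"
  shows I_const_eq: "I_const m \<alpha> d = 2 * Beta (1 - d) (1 - \<alpha> * real m) / (2 - 2 * d - \<alpha> * real m)"
    and I_const_pos: "I_const m \<alpha> d > 0"
    and integrable_osc_powr_measure:
      "integrable (leb_pow m) (\<lambda>x. (cmod (osc (powr_measure d) m (\<lambda>y j. y) x))\<^sup>2 * (\<Prod>j<m. \<bar>x j\<bar> powr (\<alpha> - 1)))"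
    and integral_osc_powr_measure:
      "(\<integral>x. (cmod (osc (powr_measure d) m (\<lambda>y j. y) x))\<^sup>2 * (\<Prod>j<m. \<bar>x j\<bar> powr (\<alpha> - 1)) \<partial>leb_pow m)
         = c_const \<alpha> ^ m * I_const m \<alpha> d"
proof -
  note pd = integrable_powr_diff_pair[OF d] integral_powr_diff_pair[OF d]
  show I: "I_const m \<alpha> d = 2 * Beta (1 - d) (1 - \<alpha> * real m) / (2 - 2 * d - \<alpha> * real m)"
    unfolding I_const_eq_pair[OF d(1)] by (rule pd(2))
  show "I_const m \<alpha> d > 0"
    unfolding I using d by (intro divide_pos_pos mult_pos_pos Beta_real_pos) auto
  \<comment> \<open>At coinciding points both sides vanish; this uses m > 0, as an empty product
    would be 1 and \<open>0 powr 0\<close> is 0.\<close>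
  have e: "(\<Prod>j<m. \<bar>fst v - snd v\<bar> powr - \<alpha>) = \<bar>fst v - snd v\<bar> powr - (\<alpha> * real m)" for v :: "real \<times> real"
    using m by (cases "fst v = snd v") (auto simp: powr_power mult.commute)
  have nz: "AE v in powr_measure d \<Otimes>\<^sub>M powr_measure d. \<forall>j<m. fst v \<noteq> snd v"
    using AE_powr_measure_pair_neq[OF d(1)] by eventually_elim simp
  have int: "integrable (powr_measure d \<Otimes>\<^sub>M powr_measure d) (\<lambda>v. \<Prod>j<m. \<bar>fst v - snd v\<bar> powr - \<alpha>)"
    unfolding e by (rule pd(1))
  have ms: "(\<lambda>y. y) \<in> borel_measurable (powr_measure d)" by measurable
  note pl = osc_plancherel[where p = "\<lambda>y j. y" and m = m, OF \<alpha> finite_measure_powr_measure[OF d(1)] ms nz int]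
  show "integrable (leb_pow m) (\<lambda>x. (cmod (osc (powr_measure d) m (\<lambda>y j. y) x))\<^sup>2 * (\<Prod>j<m. \<bar>x j\<bar> powr (\<alpha> - 1)))"
    by (rule pl(1))
  show "(\<integral>x. (cmod (osc (powr_measure d) m (\<lambda>y j. y) x))\<^sup>2 * (\<Prod>j<m. \<bar>x j\<bar> powr (\<alpha> - 1)) \<partial>leb_pow m)
         = c_const \<alpha> ^ m * I_const m \<alpha> d"
    using pl(2) unfolding e I_const_eq_pair[OF d(1)] .
qed

text \<open>The square of \<open>C_const\<close> is the reciprocal of m! times the energy just
  computed, and the sign \<epsilon> disappears on squaring.\<close>

lemma
  assumes m: "m > 0" and d: "d < 1" "\<alpha> * real m < 1" "2 * d + \<alpha> * real m < 2" and \<epsilon>: "\<epsilon> \<in> {-1, 1}"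
  shows Q1_L2: "Q1 \<epsilon> m \<alpha> d \<in> L2_space (leb_pow m)"
    and integral_Q1: "(\<integral>x. (cmod (Q1 \<epsilon> m \<alpha> d x))\<^sup>2 \<partial>leb_pow m) = 1 / fact m"
proof -
  let ?D = "fact m * c_const \<alpha> ^ m * I_const m \<alpha> d"
  have D: "?D > 0" using c_const_pos I_const_pos[OF m d] by simp
  have C: "(C_const \<epsilon> m \<alpha> d)\<^sup>2 = 1 / ?D"
    using \<epsilon> D powr_half_square[of ?D "-1"] by (auto simp: C_const_def power_mult_distrib powr_minus_divide)
  have e: "(cmod (Q1 \<epsilon> m \<alpha> d x))\<^sup>2 = 1 / ?D *
      ((cmod (osc (powr_measure d) m (\<lambda>y j. y) x))\<^sup>2 * (\<Prod>j<m. \<bar>x j\<bar> powr (\<alpha> - 1)))" for x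
    unfolding Q1_eq_osc norm_mult norm_of_real power_mult_distrib power2_abs C prod_powr_half_square by simp
  have "osc (powr_measure d) m (\<lambda>y j. y) \<in> borel_measurable (leb_pow m)"
    by (rule borel_measurable_osc[OF finite_measure_powr_measure[OF d(1)]]) measurable
  moreover have "(\<lambda>x. \<Prod>j<m. \<bar>x j\<bar> powr ((\<alpha> - 1) / 2)) \<in> borel_measurable (leb_pow m)"
    by (rule borel_measurable_leb_pow_prod) measurable
  ultimately have "Q1 \<epsilon> m \<alpha> d \<in> borel_measurable (leb_pow m)"
    unfolding Q1_eq_osc[abs_def] by measurable
  moreover have "integrable (leb_pow m) (\<lambda>x. (cmod (Q1 \<epsilon> m \<alpha> d x))\<^sup>2)"
    unfolding e by (intro integrable_mult_right integrable_osc_powr_measure[OF m d])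
  ultimately show "Q1 \<epsilon> m \<alpha> d \<in> L2_space (leb_pow m)" by (simp add: L2_space_def)
  show "(\<integral>x. (cmod (Q1 \<epsilon> m \<alpha> d x))\<^sup>2 \<partial>leb_pow m) = 1 / fact m"
    unfolding e integral_mult_right_zero integral_osc_powr_measure[OF m d]
    using c_const_pos I_const_pos[OF m d] by (simp add: field_simps)
qed

text \<open>The norm is the case m = 1, d = 0 of the energy computation. Hermitian symmetry holds
  because the underlying measure is real and the weight is even.\<close>

lemma
  shows riesz_test_HR: "riesz_test \<alpha> \<in> HR"
    and HR_norm_riesz_test: "HR_norm (riesz_test \<alpha>) = 1"
proof -
  interpret P: product_sigma_finite "\<lambda>_::nat. lborel :: real measure" ..
  interpret p0: prob_space "powr_measure 0" by (rule prob_space_powr_measure_0)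
  define K where "K = c_const \<alpha> * (2 / ((1 - \<alpha>) * (2 - \<alpha>)))"
  have K: "K > 0" unfolding K_def using c_const_pos \<alpha> by (intro mult_pos_pos divide_pos_pos) auto
  have d: "(0::real) < 1" "\<alpha> * real 1 < 1" "2 * 0 + \<alpha> * real 1 < 2" and m: "(1::nat) > 0" using \<alpha> by auto
  let ?o = "\<lambda>x. \<integral>y. iexp (y * x) \<partial>powr_measure 0"
  have om [measurable]: "?o \<in> borel_measurable borel" by measurable
  have o: "osc (powr_measure 0) 1 (\<lambda>y j. y) x = ?o (x 0)" for x
    by (simp add: osc_def)
  let ?F = "\<lambda>t. (cmod (?o t))\<^sup>2 * \<bar>t\<bar> powr (\<alpha> - 1)"
  have Fm: "?F \<in> borel_measurable lborel" by measurable
  have I: "I_const 1 \<alpha> 0 = 2 / ((1 - \<alpha>) * (2 - \<alpha>))"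
    unfolding I_const_eq[OF m d] using \<alpha> by (simp add: Beta_one_left)
  have one: "{..<1::nat} = {0}" by auto
  have int: "integrable (Pi\<^sub>M {0::nat} (\<lambda>_. lborel)) (\<lambda>x. ?F (x 0))"
    and val: "(\<integral>x. ?F (x 0) \<partial>Pi\<^sub>M {0::nat} (\<lambda>_. lborel)) = K"
    using integrable_osc_powr_measure[OF m d] integral_osc_powr_measure[OF m d]
    unfolding o I one K_def by simp_all
  \<comment> \<open>The energy lemma lives on the product over the index set {0}; this identifies it
    with the real line.\<close>
  have val': "(\<integral>t. ?F t \<partial>lborel) = K"
    using P.product_integral_singleton[of ?F 0] Fm val by simp
  \<comment> \<open>A function that is not integrable has integral 0 by convention, so the positive
    value K already implies integrability.\<close>
  have int': "integrable lborel ?F"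
    using K val' not_integrable_integral_eq[of lborel ?F] by fastforce
  have e: "(cmod (riesz_test \<alpha> x))\<^sup>2 = 1 / K * ?F x" for x
    unfolding riesz_test_def K_def[symmetric] norm_mult norm_of_real power_mult_distrib power2_abs powr_half_square
    using K by (simp add: powr_minus_divide)
  have "riesz_test \<alpha> \<in> borel_measurable borel"
    unfolding riesz_test_def[abs_def] by measurable
  moreover have "integrable lborel (\<lambda>x. (cmod (riesz_test \<alpha> x))\<^sup>2)"
    unfolding e by (intro integrable_mult_right int')
  moreover have "riesz_test \<alpha> (- x) = cnj (riesz_test \<alpha> x)" for x
  proof -
    have "iexp (y * - x) = cnj (iexp (y * x))" for y
      by (simp add: exp_cnj)
    then have "?o (- x) = cnj (?o x)"
      by (simp only: Bochner_Integration.integral_cnj)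
    then show ?thesis
      by (simp only: riesz_test_def complex_cnj_mult complex_cnj_complex_of_real abs_minus_cancel)
  qed
  ultimately show HR: "riesz_test \<alpha> \<in> HR" by (simp add: HR_def L2_space_def)
  show "HR_norm (riesz_test \<alpha>) = 1"
    unfolding HR_norm_eq[OF HR] e integral_mult_right_zero val' using K by simp
qed

text \<open>By Fubini the product of the one-dimensional transforms is the transform of the uniform
  measure on the cube, the counterpart of \<open>Q1_eq_osc\<close> for the test function.\<close>

lemma tensor_power_riesz_test:
  "tensor_power m (riesz_test \<alpha>) x
     = complex_of_real (((c_const \<alpha> * (2 / ((1 - \<alpha>) * (2 - \<alpha>)))) powr (- 1 / 2)) ^ m)
       * osc (Pi\<^sub>M {..<m} (\<lambda>_. powr_measure 0)) m (\<lambda>z j. z j) x * complex_of_real (\<Prod>j<m. \<bar>x j\<bar> powr ((\<alpha> - 1) / 2))"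
proof -
  interpret p0: prob_space "powr_measure 0" by (rule prob_space_powr_measure_0)
  interpret P: product_sigma_finite "\<lambda>_::nat. powr_measure 0" ..
  have "osc (Pi\<^sub>M {..<m} (\<lambda>_. powr_measure 0)) m (\<lambda>z j. z j) x
     = (\<integral>z. (\<Prod>j<m. iexp (z j * x j)) \<partial>Pi\<^sub>M {..<m} (\<lambda>_. powr_measure 0))"
    by (simp add: osc_def exp_sum sum_distrib_left)
  also have "\<dots> = (\<Prod>j<m. \<integral>y. iexp (y * x j) \<partial>powr_measure 0)"
    by (rule P.product_integral_prod) (auto intro!: p0.integrable_const_bound[where B = 1])
  finally show ?thesis by (simp add: tensor_power_def riesz_test_def prod.distrib)
qed

text \<open>The two half-powers of each |x_j| multiply to |x_j|^(\<alpha>-1), so the inner product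
  is, up to normalisation, the mutual Riesz energy of the weighted diagonal and the uniform cube.
  The rest is bookkeeping of constants.\<close>

lemma re_inner_riesz_test:
  assumes m: "m > 0" and d: "d < 1" "\<alpha> * real m < 1" "2 * d + \<alpha> * real m < 2" and \<epsilon>: "\<epsilon> \<in> {-1, 1}"
  shows "\<bar>re_inner (leb_pow m) (Q1 \<epsilon> m \<alpha> d) (tensor_power m (riesz_test \<alpha>))\<bar> = L_const m \<alpha> d"
    and "L_const m \<alpha> d > 0"
proof -
  let ?N = "Pi\<^sub>M {..<m} (\<lambda>_. powr_measure 0)"
  define A where "A = (c_const \<alpha> * (2 / ((1 - \<alpha>) * (2 - \<alpha>)))) powr (- 1 / 2)"
  define S where "S = (\<Sum>k=0..m. real (m choose k) * Beta (1 - d + (1 - \<alpha>) * real k) (1 + (1 - \<alpha>) * real (m - k)))"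
  let ?C = "C_const \<epsilon> m \<alpha> d"
  let ?o = "osc (powr_measure d) m (\<lambda>y j. y)" and ?o' = "osc ?N m (\<lambda>z j. z j)"
  have K: "c_const \<alpha> * (2 / ((1 - \<alpha>) * (2 - \<alpha>))) > 0" using c_const_pos \<alpha> by (intro mult_pos_pos divide_pos_pos) auto
  have A: "A > 0" unfolding A_def powr_gt_zero using K by (rule order.strict_implies_not_eq[symmetric])
  have D: "fact m * c_const \<alpha> ^ m * I_const m \<alpha> d > 0" using c_const_pos I_const_pos[OF m d] by simp
  have C: "\<bar>?C\<bar> = (fact m * c_const \<alpha> ^ m * I_const m \<alpha> d) powr (- 1 / 2)" and C0: "?C \<noteq> 0"
    using \<epsilon> order.strict_implies_not_eq[OF D] by (auto simp: C_const_def)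
  have S: "S > 0" unfolding S_def
  proof (rule sum_pos)
    fix k assume "k \<in> {0..m}"
    moreover have "(1 - \<alpha>) * real k \<ge> 0" "(1 - \<alpha>) * real (m - k) \<ge> 0" using \<alpha> by simp_all
    then have "Beta (1 - d + (1 - \<alpha>) * real k) (1 + (1 - \<alpha>) * real (m - k)) > 0"
      using d(1) by (intro Beta_real_pos) linarith+
    ultimately show "0 < real (m choose k) * Beta (1 - d + (1 - \<alpha>) * real k) (1 + (1 - \<alpha>) * real (m - k))"
      by simp
  qed auto
  have e: "Q1 \<epsilon> m \<alpha> d x * cnj (tensor_power m (riesz_test \<alpha>) x)
     = complex_of_real (?C * A ^ m) * (?o x * cnj (?o' x) * complex_of_real (\<Prod>j<m. \<bar>x j\<bar> powr (\<alpha> - 1)))" for x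
    unfolding Q1_eq_osc tensor_power_riesz_test[folded A_def] prod_powr_half_square[of x "\<alpha> - 1" m, symmetric]
    by (simp only: of_real_mult complex_cnj_mult complex_cnj_complex_of_real power2_eq_square mult_ac)
  have L2: "tensor_power m (riesz_test \<alpha>) \<in> L2_space (leb_pow m)"
    using riesz_test_HR by (intro tensor_power_L2) (simp add: HR_def)
  \<comment> \<open>The hypothesis of \<open>osc_parseval\<close>: the product of two
    square-integrable functions is integrable, and dividing by the nonzero constant ?C A^m leaves
    the bare integrand.\<close>
  have "integrable (leb_pow m) (\<lambda>x. complex_of_real (1 / (?C * A ^ m)) *
      (complex_of_real (?C * A ^ m) * (?o x * cnj (?o' x) * complex_of_real (\<Prod>j<m. \<bar>x j\<bar> powr (\<alpha> - 1)))))"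
    using L2_space_mult_cnj_integrable[OF Q1_L2[OF m d \<epsilon>] L2] unfolding e by (rule integrable_mult_right)
  moreover have "complex_of_real (1 / (?C * A ^ m)) * (complex_of_real (?C * A ^ m) * z) = z" for z
    using C0 A by simp
  ultimately have int': "integrable (leb_pow m) (\<lambda>x. ?o x * cnj (?o' x) * complex_of_real (\<Prod>j<m. \<bar>x j\<bar> powr (\<alpha> - 1)))"
    by (simp only:)
  note B = has_bochner_integral_powr_measure_PiM[OF d(1) \<alpha>(2), of m, folded S_def, unfolded has_bochner_integral_iff]
  have "(\<integral>x. ?o x * cnj (?o' x) * complex_of_real (\<Prod>j<m. \<bar>x j\<bar> powr (\<alpha> - 1)) \<partial>leb_pow m)
    = complex_of_real (c_const \<alpha> ^ m * (\<integral>v. (\<Prod>j<m. \<bar>fst v - snd v j\<bar> powr - \<alpha>) \<partial>(powr_measure d \<Otimes>\<^sub>M ?N)))"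
  proof (rule osc_parseval[OF \<alpha> _ _ _ _ _ _ int'])
    show "finite_measure (powr_measure d)" by (rule finite_measure_powr_measure[OF d(1)])
    show "finite_measure ?N" by (rule finite_measure_PiM_powr_measure_0[OF d(1) \<alpha>(2)])
    show "(\<lambda>z. z j) \<in> borel_measurable ?N" if "j < m" for j
      using measurable_component_singleton[of j "{..<m}" "\<lambda>_. powr_measure 0"] that
      by (simp cong: measurable_cong_sets)
  qed (use B AE_powr_measure_PiM_neq[OF d(1) \<alpha>(2), of m] in auto)
  then have "re_inner (leb_pow m) (Q1 \<epsilon> m \<alpha> d) (tensor_power m (riesz_test \<alpha>))
      = ?C * A ^ m * (c_const \<alpha> ^ m * (S / (1 - \<alpha>) ^ m))"
    unfolding re_inner_def e integral_mult_right_zero using B by (simp flip: of_real_mult of_real_power of_real_divide)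
  then have 1: "\<bar>re_inner (leb_pow m) (Q1 \<epsilon> m \<alpha> d) (tensor_power m (riesz_test \<alpha>))\<bar>
      = \<bar>?C\<bar> * A ^ m * (c_const \<alpha> ^ m * (S / (1 - \<alpha>) ^ m))"
    using A S c_const_pos \<alpha> by (simp add: abs_mult power_abs)
  have I: "I_const m \<alpha> d > 0" by (rule I_const_pos[OF m d])
  define c where "c = c_const \<alpha>"
  have c: "c > 0" using c_const_pos by (simp add: c_def)
  have C': "\<bar>?C\<bar> = (fact m * I_const m \<alpha> d) powr (- 1 / 2) * (c powr (- 1 / 2)) ^ m"
  proof -
    have "(c ^ m) powr (- 1 / 2) = (c powr (- 1 / 2)) ^ m"
      using c by (simp add: powr_power powr_realpow[symmetric] powr_powr mult_ac)
    moreover have "fact m * c ^ m * I_const m \<alpha> d = (fact m * I_const m \<alpha> d) * c ^ m" by simp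
    ultimately show ?thesis unfolding C c_def[symmetric] using I c by (simp only: powr_mult)
  qed
  \<comment> \<open>With rho = (2-\<alpha>)/(2(1-\<alpha>)) one has 2/((1-\<alpha>)(2-\<alpha>)) =
    1/((1-\<alpha>)^2 rho). Extracting 1-\<alpha> cancels the denominator (1-\<alpha>)^m of the
    mutual energy and leaves the power rho^(m/2) of \<open>L_const\<close>.\<close>
  have A': "A = c powr (- 1 / 2) * ((1 - \<alpha>) * ((2 - \<alpha>) / (2 * (1 - \<alpha>))) powr (1 / 2))"
  proof -
    have w: "2 / ((1 - \<alpha>) * (2 - \<alpha>)) = ((1 - \<alpha>)\<^sup>2 * ((2 - \<alpha>) / (2 * (1 - \<alpha>)))) powr -1"
    proof -
      have "(1 - \<alpha>)\<^sup>2 * ((2 - \<alpha>) / (2 * (1 - \<alpha>))) = (1 - \<alpha>) * (2 - \<alpha>) / 2"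
        using \<alpha> by (simp add: power2_eq_square field_simps)
      then show ?thesis using \<alpha> by (simp only: powr_minus_divide) simp
    qed
    have "(2 / ((1 - \<alpha>) * (2 - \<alpha>))) powr (- 1 / 2) = ((1 - \<alpha>)\<^sup>2 * ((2 - \<alpha>) / (2 * (1 - \<alpha>)))) powr (1 / 2)"
      unfolding w powr_powr by simp
    also have "\<dots> = (1 - \<alpha>) * ((2 - \<alpha>) / (2 * (1 - \<alpha>))) powr (1 / 2)"
      unfolding powr_mult using \<alpha> by (simp add: powr_half_sqrt)
    finally show ?thesis unfolding A_def c_def[symmetric] powr_mult by simp
  qed
  \<comment> \<open>The kernel and the test function each contribute c^(-m/2), and the Parseval
    formula contributes c^m.\<close>
  have cc: "(c powr (- 1 / 2)) ^ m * (c powr (- 1 / 2)) ^ m * c ^ m = 1"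
  proof -
    have "c powr (- 1 / 2) * c powr (- 1 / 2) * c = 1"
      using c powr_half_square[of c "-1"] by (simp add: power2_eq_square powr_minus)
    then show ?thesis by (simp only: power_mult_distrib[symmetric] power_one)
  qed
  have r: "((2 - \<alpha>) / (2 * (1 - \<alpha>))) powr (real m / 2) = (((2 - \<alpha>) / (2 * (1 - \<alpha>))) powr (1 / 2)) ^ m"
    using \<alpha> by (simp add: powr_power)
  have L: "L_const m \<alpha> d = (((2 - \<alpha>) / (2 * (1 - \<alpha>))) powr (1 / 2)) ^ m * S * (fact m * I_const m \<alpha> d) powr (- 1 / 2)"
    unfolding L_const_def S_def r by (simp add: powr_minus_divide)
  show "L_const m \<alpha> d > 0"
    unfolding L using S I \<alpha> by (intro mult_pos_pos zero_less_power) auto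
  have "\<bar>?C\<bar> * A ^ m * (c ^ m * (S / (1 - \<alpha>) ^ m))
      = ((c powr (- 1 / 2)) ^ m * (c powr (- 1 / 2)) ^ m * c ^ m) * L_const m \<alpha> d"
    unfolding L C' A' power_mult_distrib using \<alpha> by simp
  then show "\<bar>re_inner (leb_pow m) (Q1 \<epsilon> m \<alpha> d) (tensor_power m (riesz_test \<alpha>))\<bar> = L_const m \<alpha> d"
    unfolding 1 c_def[symmetric] by (simp only: cc mult_1)
qed

end

theorem lemma7p2:
  fixes m :: nat and \<alpha> d \<epsilon> :: real
  assumes "m \<ge> 2"
    and "0 < \<alpha>" and "\<alpha> < 1"
    and "\<alpha> * real m < 1"
    and "2 * d + \<alpha> * real m < 1"
    and "\<epsilon> \<in> {-1, 1}"
  shows "0 < L_const m \<alpha> d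
    \<and> ereal (L_const m \<alpha> d) \<le> Lambda \<epsilon> m \<alpha> d
    \<and> Lambda \<epsilon> m \<alpha> d \<le> ereal (fact m powr (- 1 / 2))
    \<and> Q1 \<epsilon> m \<alpha> d \<in> L2_space (leb_pow m)
    \<and> L2_norm (leb_pow m) (Q1 \<epsilon> m \<alpha> d) = fact m powr (- 1 / 2)
    \<and> I_const m \<alpha> d = 2 * Beta (1 - d) (1 - \<alpha> * real m) / (2 - 2 * d - \<alpha> * real m)"
proof (intro conjI)
  note \<alpha> = assms(2,3)
  have m: "m > 0" using assms(1) by simp
  have "0 \<le> \<alpha> * real m" using \<alpha> by simp
  then have d: "d < 1" "\<alpha> * real m < 1" "2 * d + \<alpha> * real m < 2"
    using assms(4,5) by auto
  have sq: "(fact m powr (- 1 / 2))\<^sup>2 = 1 / (fact m :: real)"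
    using powr_half_square[of "fact m" "-1"] by (simp add: powr_minus_divide)
  show "0 < L_const m \<alpha> d"
    by (rule re_inner_riesz_test(2)[OF \<alpha> m d assms(6)])
  show "I_const m \<alpha> d = 2 * Beta (1 - d) (1 - \<alpha> * real m) / (2 - 2 * d - \<alpha> * real m)"
    by (rule I_const_eq[OF \<alpha> m d])
  show Q: "Q1 \<epsilon> m \<alpha> d \<in> L2_space (leb_pow m)"
    by (rule Q1_L2[OF \<alpha> m d assms(6)])
  show "L2_norm (leb_pow m) (Q1 \<epsilon> m \<alpha> d) = fact m powr (- 1 / 2)"
    unfolding L2_norm_def integral_Q1[OF \<alpha> m d assms(6)] sq[symmetric] by simp
  \<comment> \<open>\<open>L_const\<close> is rewritten as the value at \<open>riesz_test\<close>, a
    unit vector and hence admissible in the supremum.\<close>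
  show "ereal (L_const m \<alpha> d) \<le> Lambda \<epsilon> m \<alpha> d"
    unfolding Lambda_def re_inner_riesz_test(1)[OF \<alpha> m d assms(6), symmetric]
    by (rule SUP_upper) (simp add: riesz_test_HR[OF \<alpha>] HR_norm_riesz_test[OF \<alpha>])
  show "Lambda \<epsilon> m \<alpha> d \<le> ereal (fact m powr (- 1 / 2))"
    unfolding Lambda_def
  proof (rule SUP_least, clarify)
    fix \<xi> assume \<xi>: "\<xi> \<in> HR" "HR_norm \<xi> \<le> 1"
    then have L2: "\<xi> \<in> L2_space lborel" by (simp add: HR_def)
    have "(\<integral>x. (cmod (\<xi> x))\<^sup>2 \<partial>lborel) \<le> 1"
      using \<xi>(2) unfolding HR_norm_eq[OF \<xi>(1)] by simp
    \<comment> \<open>The squared norm of a tensor power is the m-th power of the squared norm of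
      \<xi>, so the unit ball is mapped into the unit ball and Cauchy--Schwarz applies.\<close>
    then have "(\<integral>x. (cmod (tensor_power m \<xi> x))\<^sup>2 \<partial>leb_pow m) \<le> 1"
      unfolding integral_tensor_power[OF L2] by (intro power_le_one) auto
    then have "\<bar>re_inner (leb_pow m) (Q1 \<epsilon> m \<alpha> d) (tensor_power m \<xi>)\<bar> \<le> fact m powr (- 1 / 2)"
      by (intro re_inner_le Q tensor_power_L2 L2) (simp_all only: sq integral_Q1[OF \<alpha> m d assms(6)], auto)
    then show "ereal \<bar>re_inner (leb_pow m) (Q1 \<epsilon> m \<alpha> d) (tensor_power m \<xi>)\<bar> \<le> ereal (fact m powr (- 1 / 2))"
      by simp
  qed
qed

end
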